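(* Assume that $n\ge2$. Then, for every $\lambda>2n-1$, there exist $a\in L^\infty(\mathrm{D}^{\mathrm{I}}_{n\times n})^{\mathrm{U}(n)_L}$ and $b\in L^\infty(\mathrm{D}^{\mathrm{I}}_{n\times n})^{\mathrm{U}(n)_R}$ such that the Toeplitz operators $T^{(\lambda)}_a$ and $T^{(\lambda)}_b$ are not normal.
   Context: $\mathrm{D}^{\mathrm{I}}_{n\times n}=\{Z\in M_{n\times n}(\mathbb{C}): Z^*Z<I_n\}$. For $\lambda>2n-1$, $dv_\lambda(Z)=c_\lambda\det(I_n-ZZ^* )^{\lambda-2n}dv(Z)$, with $dv$ Lebesgue measure and $c_\lambda>0$ such that $v_\lambda(\mathrm{D}^{\mathrm{I}}_{n\times n})=1$. $\mathcal{A}^2_\lambda(\mathrm{D}^{\mathrm{I}}_{n\times n})$ is the weighted Bergman space of holomorphic functions in $L^2(\mathrm{D}^{\mathrm{I}}_{n\times n},v_\lambda)$, with orthogonal projection $B_\lambda$ from $L^2(\mathrm{D}^{\mathrm{I}}_{n\times n},v_\lambda)$. For $a\in L^\infty(\mathrm{D}^{\mathrm{I}}_{n\times n})$ (a symbol; functions equal a.e. are identified), $T^{(\lambda)}_a(f)=B_\lambda(af)$ on $\mathcal{A}^2_\lambda(\mathrm{D}^{\mathrm{I}}_{n\times n})$. $L^\infty(\mathrm{D}^{\mathrm{I}}_{n\times n})^{\mathrm{U}(n)_L}$ is the space of symbols with $a(UZ)=a(Z)$ for every $U\in\mathrm{U}(n)$, and $L^\infty(\mathrm{D}^{\mathrm{I}}_{n\times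 n})^{\mathrm{U}(n)_R}$ the space of symbols with $a(ZV)=a(Z)$ for every $V\in\mathrm{U}(n)$. *)

theory Defs
  imports "HOL-Analysis.Analysis"
begin

definition conj_transpose :: "complex^'n^'m \<Rightarrow> complex^'m^'n" where
  "conj_transpose A = (\<chi> i j. cnj (A $ j $ i))"

definition pos_def :: "complex^'n^'n \<Rightarrow> bool" where
  "pos_def A \<longleftrightarrow> conj_transpose A = A \<and>
     (\<forall>x. x \<noteq> 0 \<longrightarrow> Re (\<Sum>i\<in>UNIV. cnj (x $ i) * (A *v x) $ i) > 0)"

definition unitary_group :: "(complex^'n^'n) set" where
  "unitary_group = {U. conj_transpose U ** U = mat 1 \<and> U ** conj_transpose U = mat 1}"

definition cartan_domain :: "(complex^'n^'n) set" where
  "cartan_domain = {Z. pos_def (mat 1 - conj_transpose Z ** Z)}"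

text \<open>On the domain the determinant below is a positive real number; \<open>Re\<close> only changes its type.\<close>

definition weight :: "real \<Rightarrow> complex^'n^'n \<Rightarrow> real" where
  "weight lam Z = Re (det (mat 1 - Z ** conj_transpose Z)) powr (lam - 2 * real CARD('n))"

definition norm_const :: "'n::finite itself \<Rightarrow> real \<Rightarrow> real" where
  "norm_const _ lam = (THE c. c > 0 \<and>
     emeasure (density (lebesgue_on cartan_domain) (\<lambda>Z :: complex^'n^'n. ennreal (c * weight lam Z)))
       cartan_domain = 1)"

definition bergman_measure :: "real \<Rightarrow> (complex^'n^'n) measure" where
  "bergman_measure lam =
     density (lebesgue_on cartan_domain) (\<lambda>Z. ennreal (norm_const TYPE('n) lam * weight lam Z))"

definition L2 :: "real \<Rightarrow> (complex^'n^'n \<Rightarrow> complex) set" where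
  "L2 lam = {f. f \<in> borel_measurable (bergman_measure lam) \<and>
     integrable (bergman_measure lam) (\<lambda>Z. (cmod (f Z))\<^sup>2)}"

definition L2_inner :: "real \<Rightarrow> (complex^'n^'n \<Rightarrow> complex) \<Rightarrow> (complex^'n^'n \<Rightarrow> complex) \<Rightarrow> complex" where
  "L2_inner lam f g = (LINT Z|bergman_measure lam. f Z * cnj (g Z))"

text \<open>Holomorphy in the entries of the matrix: the real Frechet derivative exists and is
  complex linear.\<close>

definition holomorphic_on_matrices :: "(complex^'n^'n \<Rightarrow> complex) \<Rightarrow> (complex^'n^'n) set \<Rightarrow> bool" where
  "holomorphic_on_matrices f S \<longleftrightarrow> (\<forall>Z\<in>S. \<exists>f'. (f has_derivative f') (at Z) \<and>
     (\<forall>c W. f' (\<chi> i j. c * W $ i $ j) = c * f' W))"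

text \<open>A holomorphic function on the domain is represented by its extension by zero, so that
  equality in the Bergman space is equality of HOL functions.\<close>

definition bergman_space :: "real \<Rightarrow> (complex^'n^'n \<Rightarrow> complex) set" where
  "bergman_space lam = {f \<in> L2 lam. holomorphic_on_matrices f cartan_domain \<and>
     (\<forall>Z. Z \<notin> cartan_domain \<longrightarrow> f Z = 0)}"

definition bergman_projection ::
  "real \<Rightarrow> (complex^'n^'n \<Rightarrow> complex) \<Rightarrow> (complex^'n^'n \<Rightarrow> complex)" where
  "bergman_projection lam f = (THE g. g \<in> bergman_space lam \<and>
     (\<forall>h\<in>bergman_space lam. L2_inner lam (\<lambda>Z. f Z - g Z) h = 0))"

definition toeplitz ::
  "real \<Rightarrow> (complex^'n^'n \<Rightarrow> complex) \<Rightarrow> (complex^'n^'n \<Rightarrow> complex) \<Rightarrow> (complex^'n^'n \<Rightarrow> complex)" where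
  "toeplitz lam a f = bergman_projection lam (\<lambda>Z. a Z * f Z)"

text \<open>Adjoint and normality of an operator on the Bergman space; the values of the operator at
  functions outside that space are irrelevant.\<close>

definition bergman_adjoint ::
  "real \<Rightarrow> ((complex^'n^'n \<Rightarrow> complex) \<Rightarrow> (complex^'n^'n \<Rightarrow> complex))
    \<Rightarrow> (complex^'n^'n \<Rightarrow> complex) \<Rightarrow> (complex^'n^'n \<Rightarrow> complex)" where
  "bergman_adjoint lam T g = (THE h. h \<in> bergman_space lam \<and>
     (\<forall>f\<in>bergman_space lam. L2_inner lam (T f) g = L2_inner lam f h))"

definition bergman_normal ::
  "real \<Rightarrow> ((complex^'n^'n \<Rightarrow> complex) \<Rightarrow> (complex^'n^'n \<Rightarrow> complex)) \<Rightarrow> bool" where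
  "bergman_normal lam T \<longleftrightarrow> (\<forall>f\<in>bergman_space lam.
     T (bergman_adjoint lam T f) = bergman_adjoint lam T (T f))"

text \<open>Symbols are HOL functions standing for their classes modulo null sets. Accordingly the
  invariance under each fixed unitary matrix is required almost everywhere on the domain.\<close>

definition Linf :: "(complex^'n^'n \<Rightarrow> complex) set" where
  "Linf = {a. a \<in> borel_measurable (lebesgue_on cartan_domain) \<and>
     (\<exists>C. AE Z in lebesgue_on cartan_domain. cmod (a Z) \<le> C)}"

definition Linf_left :: "(complex^'n^'n \<Rightarrow> complex) set" where
  "Linf_left = {a \<in> Linf. \<forall>U\<in>unitary_group. AE Z in lebesgue_on cartan_domain. a (U ** Z) = a Z}"

definition Linf_right :: "(complex^'n^'n \<Rightarrow> complex) set" where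
  "Linf_right = {a \<in> Linf. \<forall>V\<in>unitary_group. AE Z in lebesgue_on cartan_domain. a (Z ** V) = a Z}"

end

theory Submission
  imports Defs "HOL-Complex_Analysis.Cauchy_Integral_Formula"
begin

text \<open>Fix two different indices \<open>i\<close> and \<open>j\<close>. The entry \<open>a(Z) = (Z\<^sup>* Z)\<^sub>i\<^sub>j\<close> does not change when \<open>Z\<close> is
  multiplied by a unitary matrix from the left. Multiplying the \<open>j\<close>-th column of \<open>Z\<close> by a unimodular
  number \<open>t\<close> preserves the domain and the measure, and it multiplies \<open>a\<close> by \<open>t\<close>. Let \<open>x\<^sub>p\<^sub>i\<close> be the
  coordinate function of row \<open>p\<close> and column \<open>i\<close>. The function \<open>cnj a \<cdot> x\<^sub>p\<^sub>i\<close> is multiplied by \<open>cnj t\<close>,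
  whereas a holomorphic function contains only nonnegative powers of the \<open>j\<close>-th column. By the mean
  value property the two are orthogonal (\<open>bergman_inner_line_scale_eq_0\<close>), so the adjoint of \<open>T\<^sub>a\<close>,
  which is the Toeplitz operator of \<open>cnj a\<close>, annihilates all \<open>x\<^sub>p\<^sub>i\<close>. On the other hand, \<open>a\<close> is the sum
  over \<open>p\<close> of \<open>cnj x\<^sub>p\<^sub>i \<cdot> x\<^sub>p\<^sub>j\<close>, so the inner products of \<open>a \<cdot> x\<^sub>p\<^sub>i\<close> with \<open>x\<^sub>p\<^sub>j\<close> add up to the integral of
  \<open>|a|\<^sup>2\<close>, which is positive; hence \<open>T\<^sub>a\<close> does not annihilate all \<open>x\<^sub>p\<^sub>i\<close>. Since a normal operator and its
  adjoint have the same kernel (\<open>toeplitz_not_normalI\<close>), \<open>T\<^sub>a\<close> is not normal. Rows instead of columns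
  give the symbol \<open>b(Z) = (Z Z\<^sup>*)\<^sub>j\<^sub>i\<close>, which does not change under multiplication from the right.

  This argument needs the normalizing constant, the projection and the adjoint to exist, since they
  are definite descriptions. The constant exists because the weight, a power of the determinant with
  exponent greater than \<open>-1\<close>, is integrable (\<open>nn_integral_gram_det_powr_finite\<close>): along the scalings of
  one row the determinant is an affine function of one real variable, so the rows can be integrated
  out one after the other. The projection exists because the Bergman space is closed
  (\<open>bergman_space_complete\<close>), by a local bound on point evaluations (\<open>point_evaluation_bound\<close>) that
  follows from the mean value property on circles and the invariance of the Lebesgue measure under
  complex rotations (\<open>nn_integral_lborel_isometry\<close>).\<close>

section \<open>Linear changes of variables for the Lebesgue measure\<close>

lemma nn_integral_lborel_reflect:
  fixes f :: "'a::euclidean_space \<Rightarrow> ennreal"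
  assumes "f \<in> borel_measurable borel" "c = 1 \<or> c = -1"
  shows "(\<integral>\<^sup>+x. f (a + c *\<^sub>R x) \<partial>lborel) = (\<integral>\<^sup>+x. f x \<partial>lborel)"
proof -
  have eq: "lborel = density (distr lborel borel (\<lambda>x::'a. a + c *\<^sub>R x)) (\<lambda>_. \<bar>c\<bar>^DIM('a))"
    by (rule lborel_affine) (use assms in auto)
  have "(\<integral>\<^sup>+x. f x \<partial>lborel) = (\<integral>\<^sup>+x. f x \<partial>density (distr lborel borel (\<lambda>x::'a. a + c *\<^sub>R x)) (\<lambda>_. \<bar>c\<bar>^DIM('a)))"
    using eq by metis
  also have "\<dots> = (\<integral>\<^sup>+x. f (a + c *\<^sub>R x) \<partial>lborel)"
    using assms by (subst nn_integral_density) (auto simp: nn_integral_distr)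
  finally show ?thesis ..
qed

text \<open>A translation-invariant measure is determined up to a factor; the unit ball, which an isometry
  preserves, shows that the factor is 1. The uniqueness argument is carried out directly with
  Fubini's theorem.\<close>

lemma nn_integral_lborel_isometry:
  fixes S :: "'a::euclidean_space \<Rightarrow> 'a" and f :: "'a \<Rightarrow> ennreal"
  assumes lin: "linear S" and iso: "\<And>x. norm (S x) = norm x"
    and f [measurable]: "f \<in> borel_measurable borel"
  shows "(\<integral>\<^sup>+x. f (S x) \<partial>lborel) = (\<integral>\<^sup>+x. f x \<partial>lborel)"
proof -
  have "inj S"
    using lin iso by (metis linear_injective_0 norm_eq_zero)
  then have "surj S"
    using lin linear_injective_imp_surjective by blast
  then obtain R where R: "\<And>y. S (R y) = y"
    by (metis surj_def)
  have [measurable]: "S \<in> borel_measurable borel"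
    using lin by (simp add: borel_measurable_continuous_onI linear_continuous_on linear_linear)
  define g :: "'a \<Rightarrow> ennreal" where "g = indicator (ball 0 1)"
  have [measurable]: "g \<in> borel_measurable borel"
    unfolding g_def by (intro borel_measurable_indicator) auto
  have gS: "g (S x) = g x" for x
    by (simp add: g_def indicator_def iso)
  (* The integral of f (S x + y) g y over both variables, computed in two ways by translation
     invariance; g is S-invariant, so its integral cancels at the end. *)
  have "(\<integral>\<^sup>+x. f (S x) \<partial>lborel) * (\<integral>\<^sup>+y. g y \<partial>lborel) = (\<integral>\<^sup>+y. (\<integral>\<^sup>+x. f (S x) * g y \<partial>lborel) \<partial>lborel)"
    by (simp add: nn_integral_multc nn_integral_cmult)
  also have "\<dots> = (\<integral>\<^sup>+y. (\<integral>\<^sup>+x. f (y + S x) * g y \<partial>lborel) \<partial>lborel)"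
  proof (rule nn_integral_cong)
    fix y
    have "(\<integral>\<^sup>+x. f (S x) * g y \<partial>lborel) = (\<integral>\<^sup>+x. f (S (R y + 1 *\<^sub>R x)) * g y \<partial>lborel)"
      by (rule nn_integral_lborel_reflect[symmetric, where f="\<lambda>x. f (S x) * g y"]) auto
    also have "\<dots> = (\<integral>\<^sup>+x. f (y + S x) * g y \<partial>lborel)"
      by (simp add: linear_add[OF lin] R)
    finally show "(\<integral>\<^sup>+x. f (S x) * g y \<partial>lborel) = (\<integral>\<^sup>+x. f (y + S x) * g y \<partial>lborel)" .
  qed
  also have "\<dots> = (\<integral>\<^sup>+x. (\<integral>\<^sup>+y. f (y + S x) * g y \<partial>lborel) \<partial>lborel)"
    by (rule lborel_pair.Fubini') measurable
  also have "\<dots> = (\<integral>\<^sup>+x. (\<integral>\<^sup>+y. f y * g (y - S x) \<partial>lborel) \<partial>lborel)"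
  proof (rule nn_integral_cong)
    fix x
    show "(\<integral>\<^sup>+y. f (y + S x) * g y \<partial>lborel) = (\<integral>\<^sup>+y. f y * g (y - S x) \<partial>lborel)"
      using nn_integral_lborel_reflect[where f="\<lambda>y. f y * g (y - S x)" and a="S x" and c=1]
      by (simp add: add.commute)
  qed
  also have "\<dots> = (\<integral>\<^sup>+y. (\<integral>\<^sup>+x. f y * g (y - S x) \<partial>lborel) \<partial>lborel)"
    by (rule lborel_pair.Fubini') measurable
  also have "\<dots> = (\<integral>\<^sup>+y. (\<integral>\<^sup>+x. f y * g x \<partial>lborel) \<partial>lborel)"
  proof (rule nn_integral_cong)
    fix y
    have "g (y - S x) = g (R y + (-1) *\<^sub>R x)" for x
      using gS[of "R y - x"] by (simp add: linear_diff[OF lin] R)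
    then show "(\<integral>\<^sup>+x. f y * g (y - S x) \<partial>lborel) = (\<integral>\<^sup>+x. f y * g x \<partial>lborel)"
      using nn_integral_lborel_reflect[where f="\<lambda>x. f y * g x" and a="R y" and c="-1"] by simp
  qed
  also have "\<dots> = (\<integral>\<^sup>+x. f x \<partial>lborel) * (\<integral>\<^sup>+y. g y \<partial>lborel)"
    by (simp add: nn_integral_multc nn_integral_cmult)
  finally have *: "(\<integral>\<^sup>+x. f (S x) \<partial>lborel) * (\<integral>\<^sup>+y. g y \<partial>lborel) = (\<integral>\<^sup>+x. f x \<partial>lborel) * (\<integral>\<^sup>+y. g y \<partial>lborel)" .
  have "(\<integral>\<^sup>+y. g y \<partial>lborel) = emeasure lborel (ball (0::'a) 1)"
    by (simp add: g_def)
  moreover have "emeasure lborel (ball (0::'a) 1) \<noteq> 0"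
    using open_not_negligible[of "ball (0::'a) 1"]
    by (auto simp: negligible_iff_emeasure0)
  moreover have "emeasure lborel (ball (0::'a) 1) \<noteq> top"
    using emeasure_lborel_ball_finite[of "0::'a" 1] by simp
  ultimately show ?thesis
    using * by (simp add: mult.commute[of _ "emeasure _ _"] ennreal_mult_cancel_left)
qed

lemma nn_integral_lborel_diagonal:
  fixes S :: "'a::euclidean_space \<Rightarrow> 'a" and f :: "'a \<Rightarrow> ennreal"
  assumes lin: "linear S" and S: "\<And>b. b \<in> Basis \<Longrightarrow> S b = c b *\<^sub>R b" "\<And>b. b \<in> Basis \<Longrightarrow> c b \<noteq> 0"
    and f [measurable]: "f \<in> borel_measurable borel"
  shows "(\<integral>\<^sup>+x. f x \<partial>lborel) = ennreal (\<Prod>b\<in>Basis. \<bar>c b\<bar>) * (\<integral>\<^sup>+x. f (S x) \<partial>lborel)"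
proof -
  have [measurable]: "S \<in> borel_measurable borel"
    using lin by (simp add: borel_measurable_continuous_onI linear_continuous_on linear_linear)
  have Sx: "S x = 0 + (\<Sum>b\<in>Basis. (c b * (x \<bullet> b)) *\<^sub>R b)" for x
  proof -
    have "S x = S (\<Sum>b\<in>Basis. (x \<bullet> b) *\<^sub>R b)" by (simp add: euclidean_representation)
    also have "\<dots> = (\<Sum>b\<in>Basis. (c b * (x \<bullet> b)) *\<^sub>R b)"
      by (simp add: linear_sum[OF lin] linear_scale[OF lin] S mult.commute)
    finally show ?thesis by simp
  qed
  have eq: "lborel = density (distr lborel borel S) (\<lambda>_. (\<Prod>b\<in>Basis. \<bar>c b\<bar>))"
    unfolding Sx[abs_def] by (rule lborel_affine_euclidean) (use S(2) in auto)
  have "(\<integral>\<^sup>+x. f x \<partial>lborel) = (\<integral>\<^sup>+x. f x \<partial>density (distr lborel borel S) (\<lambda>_. (\<Prod>b\<in>Basis. \<bar>c b\<bar>)))"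
    using eq by metis
  also have "\<dots> = ennreal (\<Prod>b\<in>Basis. \<bar>c b\<bar>) * (\<integral>\<^sup>+x. f (S x) \<partial>lborel)"
    by (subst nn_integral_density) (auto simp: nn_integral_distr nn_integral_cmult)
  finally show ?thesis .
qed

section \<open>Mean values on the unit circle\<close>

text \<open>The parameter interval of the circle, as a finite measure of total mass 1 that can be combined
  with other measures by Fubini's theorem.\<close>

definition angle_measure :: "real measure" where
  "angle_measure = restrict_space lborel {0..1}"

lemma finite_measure_angle_measure: "finite_measure angle_measure"
  unfolding angle_measure_def by (intro finite_measureI) (simp add: emeasure_restrict_space)

definition rot :: "real \<Rightarrow> complex" where
  "rot t = cis (2 * pi * t)"

lemma norm_rot [simp]: "norm (rot t) = 1"
  by (simp add: rot_def)

lemma rot_measurable [measurable]: "rot \<in> borel_measurable angle_measure"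
  unfolding angle_measure_def rot_def
  by (intro measurable_restrict_space1) (simp, intro borel_measurable_continuous_onI continuous_intros)

lemma emeasure_angle_measure [simp]: "emeasure angle_measure (space angle_measure) = 1"
  by (simp add: angle_measure_def emeasure_restrict_space space_restrict_space)

lemma circle_mean_value:
  assumes S: "open S" "cball 0 1 \<subseteq> S" and hol: "\<phi> holomorphic_on S"
  shows "integrable angle_measure (\<lambda>t. \<phi> (rot t))" "(\<integral>t. \<phi> (rot t) \<partial>angle_measure) = \<phi> 0"
proof -
  have "((\<lambda>u. \<phi> u / (u - 0)) has_contour_integral (2 * of_real pi * \<i> * \<phi> 0)) (circlepath 0 1)"
    by (rule Cauchy_integral_circlepath_simple) (use hol S in \<open>auto intro: holomorphic_on_subset\<close>)
  moreover have e: "exp (2 * of_real pi * \<i> * of_real t) = rot t" for t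
    by (simp add: rot_def cis_conv_exp mult_ac)
  moreover have "\<phi> (circlepath 0 1 t) / (circlepath 0 1 t - 0) * vector_derivative (circlepath 0 1) (at t within {0..1})
      = (2 * of_real pi * \<i>) * \<phi> (rot t)" if "t \<in> {0..1}" for t
  proof -
    have "vector_derivative (circlepath 0 1) (at t within {0..1}) = 2 * of_real pi * \<i> * rot t"
      using that by (simp add: vector_derivative_circlepath01 e)
    moreover have "circlepath 0 1 t = rot t"
      by (simp add: circlepath e)
    moreover have "rot t \<noteq> 0"
      by (metis norm_rot norm_zero zero_neq_one)
    ultimately show ?thesis by simp
  qed
  ultimately have "((\<lambda>t. (2 * of_real pi * \<i>) * \<phi> (rot t)) has_integral (2 * of_real pi * \<i> * \<phi> 0)) {0..1}"
    unfolding has_contour_integral_def by (metis (no_types, lifting) has_integral_eq)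
  from has_integral_mult_right[OF this, of "inverse (2 * of_real pi * \<i>)"]
  have hi: "((\<lambda>t. \<phi> (rot t)) has_integral \<phi> 0) {0..1}"
    by (simp add: field_simps)
  have "continuous_on {0..1} (\<lambda>t. \<phi> (rot t))"
    unfolding rot_def
    by (rule continuous_on_compose2[OF holomorphic_on_imp_continuous_on[OF hol]])
       (use S(2) in \<open>auto intro!: continuous_intros simp: subset_iff\<close>)
  then have si: "set_integrable lborel {0..1} (\<lambda>t. \<phi> (rot t))"
    by (rule borel_integrable_atLeastAtMost')
  show "integrable angle_measure (\<lambda>t. \<phi> (rot t))"
    using si by (simp add: angle_measure_def integrable_restrict_space set_integrable_def)
  have "(\<integral>t. \<phi> (rot t) \<partial>angle_measure) = integral {0..1} (\<lambda>t. \<phi> (rot t))"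
    using set_borel_integral_eq_integral(2)[OF si]
    by (simp add: angle_measure_def integral_restrict_space set_lebesgue_integral_def)
  then show "(\<integral>t. \<phi> (rot t) \<partial>angle_measure) = \<phi> 0"
    using hi by (simp add: integral_unique)
qed

section \<open>A singular integral on the line\<close>

text \<open>The one-dimensional reason for the condition \<open>s > -1\<close>. What matters is that the bound is
  uniform in the position \<open>q\<close> of the singularity.\<close>

lemma nn_integral_powr_shift_bound:
  fixes s :: real
  assumes "-1 < s" "s < 0"
  shows "\<exists>C<top. \<forall>q. (\<integral>\<^sup>+x. indicator {1/4..1} x * (if q < x then ennreal ((x - q) powr s) else 0) \<partial>lborel) \<le> C"
proof -
  (* The bound is 1 / (s + 1) + 1: where x - q > 1 the power is at most 1. *)
  define h :: "real \<Rightarrow> ennreal" where "h y = indicator {0..1} y * ennreal (y powr s)" for y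
  have [measurable]: "h \<in> borel_measurable borel" unfolding h_def by measurable
  have "((\<lambda>x. x powr s) has_integral 1 powr (s+1) / (s+1)) {0..1}"
    by (rule has_integral_powr_from_0) (use assms in auto)
  then have "(\<integral>\<^sup>+y. h y \<partial>lborel) = ennreal (1 powr (s+1) / (s+1))"
    unfolding h_def
    by (subst mult.commute, intro nn_integral_has_integral_lebesgue') auto
  then have hfin: "(\<integral>\<^sup>+y. h y \<partial>lborel) < top" by simp
  show ?thesis
  proof (intro exI[of _ "(\<integral>\<^sup>+y. h y \<partial>lborel) + 1"] conjI allI)
    show "(\<integral>\<^sup>+y. h y \<partial>lborel) + 1 < top" using hfin by (simp add: ennreal_add_less_top)
    fix q
    have "(\<integral>\<^sup>+x. indicator {1/4..1} x * (if q < x then ennreal ((x - q) powr s) else 0) \<partial>lborel)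
      \<le> (\<integral>\<^sup>+x. h (- q + 1 *\<^sub>R x) + indicator {1/4..1} x \<partial>lborel)"
    proof (rule nn_integral_mono)
      fix x
      have "(x - q) powr s \<le> 1" if "x - q > 1"
        using powr_mono2'[of s 1 "x - q"] that assms by simp
      then show "indicator {1/4..1} x * (if q < x then ennreal ((x - q) powr s) else 0) \<le> h (- q + 1 *\<^sub>R x) + indicator {1/4..1} x"
        by (cases "x - q > 1") (auto simp: h_def indicator_def)
    qed
    also have "\<dots> = (\<integral>\<^sup>+x. h (- q + 1 *\<^sub>R x) \<partial>lborel) + (\<integral>\<^sup>+x. indicator {1/4..1::real} x \<partial>lborel)"
      by (rule nn_integral_add) auto
    also have "(\<integral>\<^sup>+x. h (- q + 1 *\<^sub>R x) \<partial>lborel) = (\<integral>\<^sup>+y. h y \<partial>lborel)"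
      by (rule nn_integral_lborel_reflect) auto
    also have "(\<integral>\<^sup>+x. indicator {1/4..1::real} x \<partial>lborel) \<le> (1::ennreal)"
      by simp
    finally show "(\<integral>\<^sup>+x. indicator {1/4..1} x * (if q < x then ennreal ((x - q) powr s) else 0) \<partial>lborel)
      \<le> (\<integral>\<^sup>+y. h y \<partial>lborel) + 1" by (simp add: add_left_mono)
  qed
qed

definition sq_integrable :: "'a measure \<Rightarrow> ('a \<Rightarrow> complex) \<Rightarrow> bool" where
  "sq_integrable M f \<longleftrightarrow> f \<in> borel_measurable M \<and> integrable M (\<lambda>x. (cmod (f x))\<^sup>2)"

section \<open>Orthogonal projections in spaces of square-integrable functions\<close>

lemma borel_measurable_cnj [measurable (raw)]:
  "f \<in> borel_measurable M \<Longrightarrow> (\<lambda>x. cnj (f x)) \<in> borel_measurable M"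
  by (rule borel_measurable_continuous_on[of cnj]) (intro continuous_intros)

lemma sq_integrable_integrable_mult:
  assumes "sq_integrable M f" "sq_integrable M g"
  shows "integrable M (\<lambda>x. f x * cnj (g x))"
proof (rule Bochner_Integration.integrable_bound)
  show "integrable M (\<lambda>x. (cmod (f x))\<^sup>2 + (cmod (g x))\<^sup>2)"
    using assms by (simp add: sq_integrable_def)
  have [measurable]: "f \<in> borel_measurable M" "g \<in> borel_measurable M"
    using assms by (auto simp: sq_integrable_def)
  show "(\<lambda>x. f x * cnj (g x)) \<in> borel_measurable M"
    by measurable
  show "AE x in M. norm (f x * cnj (g x)) \<le> norm ((cmod (f x))\<^sup>2 + (cmod (g x))\<^sup>2)"
  proof (rule AE_I2)
    fix x
    have "0 \<le> (cmod (f x) - cmod (g x))\<^sup>2" "0 \<le> cmod (f x) * cmod (g x)" by simp_all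
    then have "cmod (f x) * cmod (g x) \<le> (cmod (f x))\<^sup>2 + (cmod (g x))\<^sup>2"
      unfolding power2_diff by linarith
    then show "norm (f x * cnj (g x)) \<le> norm ((cmod (f x))\<^sup>2 + (cmod (g x))\<^sup>2)"
      by (simp add: norm_mult)
  qed
qed

lemma sq_integrable_cmult:
  assumes "sq_integrable M f" shows "sq_integrable M (\<lambda>x. c * f x)"
proof -
  have [measurable]: "f \<in> borel_measurable M" using assms by (simp add: sq_integrable_def)
  show ?thesis using assms by (simp add: sq_integrable_def norm_mult power_mult_distrib)
qed

lemma sq_integrable_add:
  assumes "sq_integrable M f" "sq_integrable M g" shows "sq_integrable M (\<lambda>x. f x + g x)"
  unfolding sq_integrable_def
proof
  have [measurable]: "f \<in> borel_measurable M" "g \<in> borel_measurable M"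
    using assms by (auto simp: sq_integrable_def)
  show "(\<lambda>x. f x + g x) \<in> borel_measurable M" by measurable
  show "integrable M (\<lambda>x. (cmod (f x + g x))\<^sup>2)"
  proof (rule Bochner_Integration.integrable_bound)
    show "integrable M (\<lambda>x. 2 * (cmod (f x))\<^sup>2 + 2 * (cmod (g x))\<^sup>2)"
      using assms by (simp add: sq_integrable_def)
    show "(\<lambda>x. (cmod (f x + g x))\<^sup>2) \<in> borel_measurable M" by measurable
    have "(cmod (a + b))\<^sup>2 \<le> 2 * (cmod a)\<^sup>2 + 2 * (cmod b)\<^sup>2" for a b
    proof -
      have "(cmod (a + b))\<^sup>2 \<le> (cmod a + cmod b)\<^sup>2"
        by (simp add: norm_triangle_ineq power_mono)
      moreover have "0 \<le> (cmod a - cmod b)\<^sup>2" by simp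
      ultimately show ?thesis unfolding power2_diff power2_sum by linarith
    qed
    then show "AE x in M. norm ((cmod (f x + g x))\<^sup>2) \<le> norm (2 * (cmod (f x))\<^sup>2 + 2 * (cmod (g x))\<^sup>2)"
      by simp
  qed
qed

lemma sq_integrable_diff:
  assumes "sq_integrable M f" "sq_integrable M g" shows "sq_integrable M (\<lambda>x. f x - g x)"
  using sq_integrable_add[OF assms(1) sq_integrable_cmult[OF assms(2), of "-1"]] by simp

text \<open>The best approximation exists because a minimizing sequence is Cauchy by the parallelogram law,
  and a pointwise limit of it still minimizes by Fatou's lemma. This is why pointwise limits
  almost everywhere are enough in the completeness hypothesis.\<close>

lemma orthogonal_projection_exists:
  fixes M :: "'a measure" and A :: "('a \<Rightarrow> complex) set"
  assumes A: "\<And>f. f \<in> A \<Longrightarrow> sq_integrable M f" "A \<noteq> {}"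
    and add: "\<And>f g. f \<in> A \<Longrightarrow> g \<in> A \<Longrightarrow> (\<lambda>x. f x + g x) \<in> A"
    and cmult: "\<And>f c. f \<in> A \<Longrightarrow> (\<lambda>x. c * f x) \<in> A"
    and complete: "\<And>g. (\<And>k::nat. g k \<in> A) \<Longrightarrow>
        (\<And>e. e > 0 \<Longrightarrow> \<exists>N. \<forall>k\<ge>N. \<forall>l\<ge>N. (\<integral>x. (cmod (g k x - g l x))\<^sup>2 \<partial>M) < e) \<Longrightarrow>
        \<exists>G\<in>A. AE x in M. (\<lambda>k. g k x) \<longlonglongrightarrow> G x"
    and F: "sq_integrable M F"
  shows "\<exists>G\<in>A. \<forall>h\<in>A. (\<integral>x. (F x - G x) * cnj (h x) \<partial>M) = 0"
proof -
  define n2 where "n2 f = (\<integral>x. (cmod (f x))\<^sup>2 \<partial>M)" for f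
  define d where "d = (INF g\<in>A. n2 (\<lambda>x. F x - g x))"
  have n2_nonneg: "0 \<le> n2 f" for f by (simp add: n2_def)
  have bdd: "bdd_below ((\<lambda>g. n2 (\<lambda>x. F x - g x)) ` A)"
    using n2_nonneg by (auto intro: bdd_belowI[of _ 0])
  have d_le: "d \<le> n2 (\<lambda>x. F x - g x)" if "g \<in> A" for g
    unfolding d_def using bdd that by (rule cINF_lower)
  have "\<exists>g\<in>A. n2 (\<lambda>x. F x - g x) < d + 1 / real (Suc k)" for k
    using cINF_less_iff[OF A(2) bdd, of "d + 1 / real (Suc k)"] by (simp add: d_def)
  then obtain g where g: "\<And>k. g k \<in> A" "\<And>k. n2 (\<lambda>x. F x - g k x) < d + 1 / real (Suc k)"
    by metis
  have diff: "sq_integrable M (\<lambda>x. F x - h x)" if "h \<in> A" for h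
    using sq_integrable_diff[OF F A(1)[OF that]] .
  have par: "n2 (\<lambda>x. g k x - g l x) < 2 / real (Suc k) + 2 / real (Suc l)" for k l
  proof -
    define m where "m x = (1/2) * (g k x + g l x)" for x
    have m: "m \<in> A" unfolding m_def by (intro cmult add g)
    (* Parallelogram law for F - g k and F - g l; m is the midpoint of g k and g l. *)
    have pt: "(cmod (g k x - g l x))\<^sup>2 =
       2 * (cmod (F x - g k x))\<^sup>2 + 2 * (cmod (F x - g l x))\<^sup>2 - 4 * (cmod (F x - m x))\<^sup>2" for x
      unfolding m_def cmod_power2 by (simp add: power2_eq_square algebra_simps)
    have "n2 (\<lambda>x. g k x - g l x) = 2 * n2 (\<lambda>x. F x - g k x) + 2 * n2 (\<lambda>x. F x - g l x) - 4 * n2 (\<lambda>x. F x - m x)"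
      using diff[OF g(1)[of k]] diff[OF g(1)[of l]] diff[OF m]
      unfolding n2_def pt by (simp add: sq_integrable_def)
    moreover have "d \<le> n2 (\<lambda>x. F x - m x)" using d_le[OF m] .
    ultimately have "n2 (\<lambda>x. g k x - g l x) < 2 * (1 / real (Suc k)) + 2 * (1 / real (Suc l))"
      using g(2)[of k] g(2)[of l] by linarith
    then show ?thesis by simp
  qed
  have "\<exists>N. \<forall>k\<ge>N. \<forall>l\<ge>N. (\<integral>x. (cmod (g k x - g l x))\<^sup>2 \<partial>M) < e" if e: "e > 0" for e
  proof -
    obtain N where N: "4 / e < real N" using reals_Archimedean2 by blast
    then have N': "4 / real (Suc N) < e"
      using e by (simp add: field_simps)
    show ?thesis
    proof (intro exI allI impI)
      fix k l assume "N \<le> k" "N \<le> l"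
      then have "2 / real (Suc k) \<le> 2 / real (Suc N)" "2 / real (Suc l) \<le> 2 / real (Suc N)"
        by (auto intro!: divide_left_mono)
      then show "(\<integral>x. (cmod (g k x - g l x))\<^sup>2 \<partial>M) < e"
        using par[of k l] N' unfolding n2_def by linarith
    qed
  qed
  then obtain G where G: "G \<in> A" "AE x in M. (\<lambda>k. g k x) \<longlonglongrightarrow> G x"
    using complete[of g] g(1) by blast
  have n2G: "n2 (\<lambda>x. F x - G x) \<le> d"
  proof -
    have en: "ennreal (n2 f) = (\<integral>\<^sup>+x. ennreal ((cmod (f x))\<^sup>2) \<partial>M)" if "sq_integrable M f" for f
      using that unfolding n2_def sq_integrable_def by (subst nn_integral_eq_integral) auto
    have "ennreal (n2 (\<lambda>x. F x - G x)) = (\<integral>\<^sup>+x. liminf (\<lambda>k. ennreal ((cmod (F x - g k x))\<^sup>2)) \<partial>M)"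
      unfolding en[OF diff[OF G(1)]]
    proof (rule nn_integral_cong_AE, use G(2) in eventually_elim)
      case (elim x)
      then have "(\<lambda>k. ennreal ((cmod (F x - g k x))\<^sup>2)) \<longlonglongrightarrow> ennreal ((cmod (F x - G x))\<^sup>2)"
        by (intro tendsto_intros)
      then show ?case by (intro lim_imp_Liminf[symmetric]) auto
    qed
    also have "\<dots> \<le> liminf (\<lambda>k. \<integral>\<^sup>+x. ennreal ((cmod (F x - g k x))\<^sup>2) \<partial>M)"
    proof (rule nn_integral_liminf)
      fix k
      have [measurable]: "F \<in> borel_measurable M" "g k \<in> borel_measurable M"
        using F A(1)[OF g(1)] by (auto simp: sq_integrable_def)
      show "(\<lambda>x. ennreal ((cmod (F x - g k x))\<^sup>2)) \<in> borel_measurable M" by measurable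
    qed
    also have "\<dots> \<le> liminf (\<lambda>k. ennreal (d + 1 / real (Suc k)))"
    proof (rule Liminf_mono, rule always_eventually, rule allI)
      fix k
      show "(\<integral>\<^sup>+x. ennreal ((cmod (F x - g k x))\<^sup>2) \<partial>M) \<le> ennreal (d + 1 / real (Suc k))"
        using g(2)[of k] by (simp add: en[OF diff[OF g(1)], symmetric] ennreal_leI)
    qed
    also have "(\<lambda>k. ennreal (d + 1 / real (Suc k))) \<longlonglongrightarrow> ennreal (d + 0)"
      by (intro tendsto_intros LIMSEQ_Suc lim_inverse_n')
    then have "liminf (\<lambda>k. ennreal (d + 1 / real (Suc k))) = ennreal d"
      by (simp add: lim_imp_Liminf)
    finally show ?thesis
      using n2_nonneg A(2) unfolding d_def by (subst (asm) ennreal_le_iff) (auto intro!: cINF_greatest)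
  qed
  have "(\<integral>x. (F x - G x) * cnj (h x) \<partial>M) = 0" if h: "h \<in> A" for h
  proof -
    define u where "u x = F x - G x" for x
    define c where "c = (\<integral>x. u x * cnj (h x) \<partial>M)"
    have u: "sq_integrable M u" unfolding u_def by (rule diff[OF G(1)])
    (* Moving from G in the direction c h by a small \<epsilon> > 0 changes the squared distance by
       - 2 \<epsilon> |c|^2 + \<epsilon>^2 |c|^2 |h|^2, which is negative for this \<epsilon> unless c = 0. *)
    define \<epsilon> where "\<epsilon> = 1 / (n2 h + 1)"
    have \<epsilon>: "\<epsilon> > 0" using n2_nonneg[of h] by (simp add: \<epsilon>_def)
    define t where "t = of_real \<epsilon> * c"
    have pt: "(cmod (u x - t * h x))\<^sup>2 = (cmod (u x))\<^sup>2 - 2 * Re (cnj t * (u x * cnj (h x))) + (cmod t)\<^sup>2 * (cmod (h x))\<^sup>2" for x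
      unfolding cmod_power2 by (simp add: power2_eq_square algebra_simps)
    have iuh: "integrable M (\<lambda>x. u x * cnj (h x))"
      by (rule sq_integrable_integrable_mult[OF u A(1)[OF h]])
    have itc: "integrable M (\<lambda>x. cnj t * (u x * cnj (h x)))" using iuh by simp
    then have ire: "integrable M (\<lambda>x. 2 * Re (cnj t * (u x * cnj (h x))))"
      by (intro integrable_mult_right[OF integrable_Re])
    have iu: "integrable M (\<lambda>x. (cmod (u x))\<^sup>2)" and ih: "integrable M (\<lambda>x. (cmod t)\<^sup>2 * (cmod (h x))\<^sup>2)"
      using u A(1)[OF h] by (simp_all add: sq_integrable_def)
    have "n2 (\<lambda>x. u x - t * h x) = n2 u - (\<integral>x. 2 * Re (cnj t * (u x * cnj (h x))) \<partial>M) + (cmod t)\<^sup>2 * n2 h"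
      unfolding n2_def pt
      by (subst Bochner_Integration.integral_add[OF Bochner_Integration.integrable_diff[OF iu ire] ih],
          subst Bochner_Integration.integral_diff[OF iu ire]) simp
    also have "(\<integral>x. 2 * Re (cnj t * (u x * cnj (h x))) \<partial>M) = 2 * Re (cnj t * c)"
      unfolding c_def by (subst integral_mult_right_zero, subst integral_Re[OF itc], subst integral_mult_right_zero) (simp_all add: iuh)
    also have "cnj t * c = of_real (\<epsilon> * (cmod c)\<^sup>2)"
      by (simp add: t_def mult.assoc complex_norm_square[symmetric] mult.commute[of "cnj c"] del: of_real_power)
    also have "(cmod t)\<^sup>2 = \<epsilon>\<^sup>2 * (cmod c)\<^sup>2" using \<epsilon> by (simp add: t_def norm_mult power_mult_distrib)
    finally have e: "n2 (\<lambda>x. u x - t * h x) = n2 u - 2 * (\<epsilon> * (cmod c)\<^sup>2) + \<epsilon>\<^sup>2 * (cmod c)\<^sup>2 * n2 h"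
      by simp
    have "n2 u \<le> n2 (\<lambda>x. u x - t * h x)"
    proof -
      have "(\<lambda>x. G x + t * h x) \<in> A" by (intro add cmult G(1) h)
      from d_le[OF this] have "d \<le> n2 (\<lambda>x. u x - t * h x)" by (simp add: u_def algebra_simps)
      then show ?thesis using n2G by (simp add: u_def[abs_def])
    qed
    with e have "2 * (\<epsilon> * (cmod c)\<^sup>2) \<le> \<epsilon> * (\<epsilon> * n2 h) * (cmod c)\<^sup>2"
      by (simp add: power2_eq_square mult_ac)
    moreover have "\<epsilon> * n2 h \<le> 1" using n2_nonneg[of h] by (simp add: \<epsilon>_def)
    then have "\<epsilon> * (\<epsilon> * n2 h) * (cmod c)\<^sup>2 \<le> \<epsilon> * 1 * (cmod c)\<^sup>2"
      using \<epsilon> by (intro mult_right_mono mult_left_mono) auto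
    ultimately have "\<epsilon> * (cmod c)\<^sup>2 \<le> 0" by simp
    then have "c = 0" using \<epsilon> by (simp add: mult_le_0_iff)
    then show ?thesis by (simp add: c_def u_def)
  qed
  with G(1) show ?thesis by blast
qed

text \<open>Fatou's lemma applied to the differences to one far member of the sequence.\<close>

lemma sq_integrable_L2_Cauchy_limit:
  fixes g :: "nat \<Rightarrow> 'a \<Rightarrow> complex"
  assumes g: "\<And>k. sq_integrable M (g k)" and G: "G \<in> borel_measurable M"
    and cauchy: "\<And>e. e > 0 \<Longrightarrow> \<exists>N. \<forall>k\<ge>N. \<forall>l\<ge>N. (\<integral>x. (cmod (g k x - g l x))\<^sup>2 \<partial>M) < e"
    and lim: "AE x in M. (\<lambda>k. g k x) \<longlonglongrightarrow> G x"
  shows "sq_integrable M G"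
proof -
  obtain N where N: "\<And>k. k \<ge> N \<Longrightarrow> (\<integral>x. (cmod (g N x - g k x))\<^sup>2 \<partial>M) < 1"
    using cauchy[of 1] by auto
  have [measurable]: "G \<in> borel_measurable M" "\<And>k. g k \<in> borel_measurable M"
    using g G by (auto simp: sq_integrable_def)
  have "(\<integral>\<^sup>+x. ennreal ((cmod (g N x - G x))\<^sup>2) \<partial>M) = (\<integral>\<^sup>+x. liminf (\<lambda>k. ennreal ((cmod (g N x - g k x))\<^sup>2)) \<partial>M)"
  proof (rule nn_integral_cong_AE, use lim in eventually_elim)
    case (elim x)
    then have "(\<lambda>k. ennreal ((cmod (g N x - g k x))\<^sup>2)) \<longlonglongrightarrow> ennreal ((cmod (g N x - G x))\<^sup>2)"
      by (intro tendsto_intros)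
    then show ?case by (intro lim_imp_Liminf[symmetric]) auto
  qed
  also have "\<dots> \<le> liminf (\<lambda>k. \<integral>\<^sup>+x. ennreal ((cmod (g N x - g k x))\<^sup>2) \<partial>M)"
    by (rule nn_integral_liminf) measurable
  also have "\<dots> \<le> liminf (\<lambda>k. 1)"
  proof (rule Liminf_mono, rule eventually_sequentiallyI)
    fix k assume "N \<le> k"
    have "(\<integral>\<^sup>+x. ennreal ((cmod (g N x - g k x))\<^sup>2) \<partial>M) = ennreal (\<integral>x. (cmod (g N x - g k x))\<^sup>2 \<partial>M)"
      using sq_integrable_diff[OF g g] by (intro nn_integral_eq_integral) (auto simp: sq_integrable_def)
    also have "\<dots> \<le> 1" using N[OF \<open>N \<le> k\<close>] by (simp add: ennreal_le_1)
    finally show "(\<integral>\<^sup>+x. ennreal ((cmod (g N x - g k x))\<^sup>2) \<partial>M) \<le> 1" .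
  qed
  also have "\<dots> < \<infinity>" by (simp add: Liminf_const)
  finally have "sq_integrable M (\<lambda>x. g N x - G x)"
    unfolding sq_integrable_def by (intro conjI integrableI_nonneg) auto
  from sq_integrable_diff[OF g[of N] this] show ?thesis by simp
qed

section \<open>The Cartan domain as an operator norm ball\<close>

lemma conj_transpose_nth [simp]: "conj_transpose A $ i $ j = cnj (A $ j $ i)"
  by (simp add: conj_transpose_def)

lemma conj_transpose_mult: "conj_transpose (A ** B) = conj_transpose B ** conj_transpose A"
  by (simp add: vec_eq_iff matrix_matrix_mult_def mult.commute)

lemma conj_transpose_involution [simp]: "conj_transpose (conj_transpose A) = A"
  by (simp add: vec_eq_iff)

lemma conj_transpose_diff: "conj_transpose (A - B) = conj_transpose A - conj_transpose B"
  by (simp add: vec_eq_iff)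

lemma matrix_mult_diff_left: "(A - B) ** C = A ** C - B ** C" for A :: "'a::ring_1^'n^'m"
  by (simp add: vec_eq_iff matrix_matrix_mult_def left_diff_distrib sum_subtractf)

lemma matrix_mult_diff_right: "C ** (A - B) = C ** A - C ** B" for C :: "'a::ring_1^'n^'m"
  by (simp add: vec_eq_iff matrix_matrix_mult_def right_diff_distrib sum_subtractf)

lemma conj_transpose_mat1 [simp]: "conj_transpose (mat 1) = mat 1"
  by (simp add: vec_eq_iff mat_def)

lemma norm_vector_sq: "(norm x)\<^sup>2 = (\<Sum>i\<in>UNIV. (norm (x $ i))\<^sup>2)"
  by (simp add: norm_vec_def L2_set_def sum_nonneg)

definition herm :: "complex^'n \<Rightarrow> complex^'n \<Rightarrow> complex" where
  "herm x y = (\<Sum>i\<in>UNIV. cnj (x $ i) * y $ i)"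

lemma herm_self: "herm x x = of_real ((norm x)\<^sup>2)"
  by (simp add: herm_def norm_vector_sq complex_norm_square mult.commute del: of_real_power)

lemma herm_adjoint: "herm x (A *v y) = herm (conj_transpose A *v x) y"
proof -
  have "herm x (A *v y) = (\<Sum>i\<in>UNIV. \<Sum>j\<in>UNIV. cnj (x $ i) * (A $ i $ j * y $ j))"
    by (simp add: herm_def matrix_vector_mult_def sum_distrib_left)
  also have "\<dots> = (\<Sum>j\<in>UNIV. \<Sum>i\<in>UNIV. cnj (x $ i) * (A $ i $ j * y $ j))"
    by (rule sum.swap)
  also have "\<dots> = herm (conj_transpose A *v x) y"
    by (simp add: herm_def matrix_vector_mult_def sum_distrib_right mult.assoc mult.left_commute)
  finally show ?thesis .
qed

text \<open>The domain is the open unit ball of the operator norm. All its geometric properties are read off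
  from this form.\<close>

lemma cartan_domain_iff:
  "Z \<in> cartan_domain \<longleftrightarrow> (\<forall>x. x \<noteq> 0 \<longrightarrow> norm (Z *v x) < norm x)"
  for Z :: "complex^'n^'n"
proof -
  have "(\<Sum>i\<in>UNIV. cnj (x $ i) * ((mat 1 - conj_transpose Z ** Z) *v x) $ i)
      = of_real ((norm x)\<^sup>2 - (norm (Z *v x))\<^sup>2)" for x
  proof -
    have "(\<Sum>i\<in>UNIV. cnj (x $ i) * ((mat 1 - conj_transpose Z ** Z) *v x) $ i)
       = herm x x - herm x (conj_transpose Z *v (Z *v x))"
      by (simp add: herm_def matrix_vector_mult_diff_rdistrib matrix_vector_mul_assoc right_diff_distrib sum_subtractf)
    also have "herm x (conj_transpose Z *v (Z *v x)) = herm (Z *v x) (Z *v x)"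
      by (simp add: herm_adjoint)
    finally show ?thesis by (simp add: herm_self)
  qed
  moreover have "(norm x)\<^sup>2 - (norm (Z *v x))\<^sup>2 > 0 \<longleftrightarrow> norm (Z *v x) < norm x" for x
    by (metis diff_gt_0_iff_gt norm_ge_zero pos2 power_mono_iff power_strict_mono linorder_not_le)
  moreover have "conj_transpose (mat 1 - conj_transpose Z ** Z) = mat 1 - conj_transpose Z ** Z"
    by (simp add: conj_transpose_diff conj_transpose_mult)
  ultimately show ?thesis
    unfolding cartan_domain_def pos_def_def mem_Collect_eq by (simp only: Re_complex_of_real simp_thms)
qed

definition diag :: "('n \<Rightarrow> complex) \<Rightarrow> complex^'n^'n" where
  "diag d = (\<chi> i j. if i = j then d i else 0)"

lemma diag_mult_left [simp]: "(diag d ** Z) $ i $ k = d i * Z $ i $ k"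
  by (simp add: diag_def matrix_matrix_mult_def if_distrib[where f="\<lambda>x. x * _"] cong: if_cong)

lemma diag_mult_right [simp]: "(Z ** diag d) $ i $ k = Z $ i $ k * d k"
  by (simp add: diag_def matrix_matrix_mult_def if_distrib[where f="\<lambda>x. _ * x"] cong: if_cong)

lemma diag_mult_vector [simp]: "(diag d *v x) $ i = d i * x $ i"
  by (simp add: diag_def matrix_vector_mult_def if_distrib[where f="\<lambda>x. x * _"] cong: if_cong)

lemma conj_transpose_diag: "conj_transpose (diag d) = diag (\<lambda>i. cnj (d i))"
  by (auto simp: vec_eq_iff diag_def)

lemma diag_mult_diag: "diag d ** diag e = diag (\<lambda>i. d i * e i)"
  by (auto simp: vec_eq_iff) (auto simp: diag_def)

lemma diag_one: "diag (\<lambda>i. 1) = mat 1"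
  by (simp add: diag_def mat_def)

lemma norm_diag_mult_le:
  assumes "\<And>i. cmod (d i) \<le> 1"
  shows "norm (diag d *v x) \<le> norm x"
  using assms
  by (simp add: norm_vec_def norm_mult L2_set_mono mult_left_le_one_le)

lemma cartan_domain_diag:
  fixes Z :: "complex^'n^'n"
  assumes "Z \<in> cartan_domain" "\<And>i. cmod (d i) \<le> 1"
  shows "diag d ** Z \<in> cartan_domain" "Z ** diag d \<in> cartan_domain"
proof -
  have Z: "norm (Z *v x) < norm x" if "x \<noteq> 0" for x
    using assms(1) that by (simp add: cartan_domain_iff)
  have d: "norm (diag d *v x) \<le> norm x" for x
    using norm_diag_mult_le assms(2) .
  show "diag d ** Z \<in> cartan_domain"
    unfolding cartan_domain_iff
    by (metis Z d order_le_less_trans matrix_vector_mul_assoc)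
  show "Z ** diag d \<in> cartan_domain"
    unfolding cartan_domain_iff
  proof (intro allI impI)
    fix x :: "complex^'n" assume x: "x \<noteq> 0"
    show "norm ((Z ** diag d) *v x) < norm x"
    proof (cases "diag d *v x = 0")
      case True
      then show ?thesis using x by (simp flip: matrix_vector_mul_assoc)
    next
      case False
      then show ?thesis using Z[OF False] d[of x] by (simp flip: matrix_vector_mul_assoc)
    qed
  qed
qed

lemma norm_matrix_vector_mult_le:
  fixes A :: "complex^'n^'n"
  shows "norm (A *v x) \<le> (real CARD('n))\<^sup>2 * norm A * norm x"
proof -
  have "norm (A *v x) \<le> (\<Sum>i\<in>UNIV. cmod ((A *v x) $ i))"
    unfolding norm_vec_def by (rule L2_set_le_sum) simp
  also have "\<dots> \<le> (\<Sum>i\<in>(UNIV::'n set). \<Sum>j\<in>(UNIV::'n set). norm A * norm x)"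
  proof (rule sum_mono)
    fix i
    have "cmod ((A *v x) $ i) \<le> (\<Sum>j\<in>UNIV. cmod (A $ i $ j * x $ j))"
      unfolding matrix_vector_mult_def by (simp add: norm_sum)
    also have "\<dots> \<le> (\<Sum>j\<in>(UNIV::'n set). norm A * norm x)"
      unfolding norm_mult
      by (intro sum_mono mult_mono) (auto intro: order_trans[OF Finite_Cartesian_Product.norm_nth_le] Finite_Cartesian_Product.norm_nth_le)
    finally show "cmod ((A *v x) $ i) \<le> (\<Sum>j\<in>(UNIV::'n set). norm A * norm x)" .
  qed
  also have "\<dots> = (real CARD('n))\<^sup>2 * norm A * norm x"
    by (simp add: power2_eq_square)
  finally show ?thesis .
qed

lemma scaleR_matrix_vector: "(c *\<^sub>R A) *v x = c *\<^sub>R (A *v x)" "A *v (c *\<^sub>R x) = c *\<^sub>R (A *v x)"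
  for A :: "complex^'n^'n"
  by (simp_all add: vec_eq_iff matrix_vector_mult_def scaleR_sum_right)

text \<open>By compactness of the unit sphere the supremum of \<open>norm (Z *v x)\<close> over unit vectors is attained,
  so it stays away from 1.\<close>

lemma open_cartan_domain: "open (cartan_domain :: (complex^'n^'n) set)"
  unfolding open_contains_ball
proof (rule ballI)
  fix Z :: "complex^'n^'n" assume Z: "Z \<in> cartan_domain"
  have "continuous_on (sphere 0 1) (\<lambda>x::complex^'n. norm (Z *v x))"
    unfolding matrix_vector_mult_def by (intro continuous_intros)
  moreover have "sphere (0::complex^'n) 1 \<noteq> {}" by simp
  ultimately obtain u where u: "u \<in> sphere 0 1" "\<And>x. x \<in> sphere 0 1 \<Longrightarrow> norm (Z *v x) \<le> norm (Z *v u)"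
    using continuous_attains_sup[of "sphere (0::complex^'n) 1" "\<lambda>x. norm (Z *v x)"] by auto
  define m where "m = norm (Z *v u)"
  define C where "C = (real CARD('n))\<^sup>2"
  have m: "m < 1" using Z u(1) unfolding m_def cartan_domain_iff by (metis dist_0_norm mem_sphere norm_zero zero_neq_one)
  have C: "C > 0" by (simp add: C_def)
  have "ball Z ((1 - m) / C) \<subseteq> cartan_domain"
  proof (rule subsetI)
    fix W assume "W \<in> ball Z ((1 - m) / C)"
    then have W: "C * norm (W - Z) < 1 - m"
      using C by (simp add: dist_norm norm_minus_commute field_simps)
    show "W \<in> cartan_domain" unfolding cartan_domain_iff
    proof (intro allI impI)
      fix x :: "complex^'n" assume x: "x \<noteq> 0"
      define v where "v = inverse (norm x) *\<^sub>R x"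
      have v: "norm v = 1" "x = norm x *\<^sub>R v" using x by (auto simp: v_def)
      have "W *v v = Z *v v + (W - Z) *v v" by (simp add: matrix_vector_mult_diff_rdistrib)
      then have "norm (W *v v) \<le> norm (Z *v v) + norm ((W - Z) *v v)" by (metis norm_triangle_ineq)
      also have "norm (Z *v v) \<le> m" unfolding m_def using u(2) v(1) by simp
      also have "norm ((W - Z) *v v) \<le> C * norm (W - Z) * norm v"
        unfolding C_def by (rule norm_matrix_vector_mult_le)
      finally have "norm (W *v v) < 1" using W v(1) by simp
      moreover have "norm (W *v x) = norm x * norm (W *v v)"
        by (subst v(2)) (simp add: scaleR_matrix_vector)
      ultimately show "norm (W *v x) < norm x" using x by simp
    qed
  qed
  moreover have "(1 - m) / C > 0" using m C by simp
  ultimately show "\<exists>e>0. ball Z e \<subseteq> cartan_domain" by blast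
qed

lemma zero_in_cartan_domain [simp]: "0 \<in> cartan_domain"
  by (simp add: cartan_domain_iff)

lemma cartan_domain_entry_le:
  assumes "Z \<in> cartan_domain" shows "cmod (Z $ i $ j) \<le> 1"
proof -
  have "norm (Z *v axis j 1) < norm (axis j 1 :: complex^'a)"
    using assms unfolding cartan_domain_iff by (metis axis_eq_0_iff zero_neq_one)
  moreover have "norm (axis j (1::complex) :: complex^'a) = 1"
    by (simp add: norm_vec_def L2_set_def axis_def if_distrib[of "\<lambda>x. (norm x)\<^sup>2"] cong: if_cong)
  moreover have "cmod ((Z *v axis j 1) $ i) \<le> norm (Z *v axis j 1)"
    by (rule Finite_Cartesian_Product.norm_nth_le)
  moreover have "(Z *v axis j 1) $ i = Z $ i $ j"
    by (simp add: matrix_vector_mult_def axis_def if_distrib[of "\<lambda>x. _ * x"] cong: if_cong)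
  ultimately show ?thesis by simp
qed

lemma bounded_cartan_domain: "bounded (cartan_domain :: (complex^'n^'n) set)"
proof (rule boundedI)
  fix Z :: "complex^'n^'n" assume Z: "Z \<in> cartan_domain"
  let ?B = "\<Sum>i\<in>(UNIV::'n set). \<Sum>j\<in>(UNIV::'n set). 1 :: real"
  have "norm Z \<le> (\<Sum>i\<in>UNIV. norm (Z $ i))"
    unfolding norm_vec_def[of Z] by (rule L2_set_le_sum) simp
  also have "\<dots> \<le> (\<Sum>i\<in>UNIV. \<Sum>j\<in>UNIV. cmod (Z $ i $ j))"
    unfolding norm_vec_def by (intro sum_mono L2_set_le_sum) simp
  also have "\<dots> \<le> (\<Sum>i\<in>(UNIV::'n set). \<Sum>j\<in>(UNIV::'n set). 1)"
    by (intro sum_mono cartan_domain_entry_le Z)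
  finally show "norm Z \<le> ?B" .
qed

section \<open>The Gram determinant\<close>

lemma det_conj_transpose: "det (conj_transpose A) = cnj (det A)"
proof -
  have "det (conj_transpose A) = det (\<chi> i j. cnj (A $ i $ j))"
    by (subst det_transpose[symmetric]) (simp add: transpose_def conj_transpose_def)
  also have "\<dots> = cnj (det A)"
    by (simp add: det_def)
  finally show ?thesis .
qed

text \<open>The determinant whose powers are the weights, as a function on all matrices. The real part is
  taken for the type only: the determinant of a Hermitian matrix is real.\<close>

definition gram_det :: "complex^'n^'n \<Rightarrow> real" where
  "gram_det Z = Re (det (mat 1 - Z ** conj_transpose Z))"

lemma continuous_on_det:
  fixes A :: "'a::topological_space \<Rightarrow> complex^'n^'n"
  assumes "\<And>i j. continuous_on S (\<lambda>x. A x $ i $ j)"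
  shows "continuous_on S (\<lambda>x. det (A x))"
  unfolding det_def by (intro continuous_intros assms)

lemma continuous_on_gram_det [continuous_intros]:
  assumes "continuous_on S A" shows "continuous_on S (\<lambda>x. gram_det (A x))"
  unfolding gram_det_def
  by (intro continuous_intros continuous_on_det)
     (simp add: matrix_matrix_mult_def, intro continuous_intros assms)

lemma det_gram_nonzero:
  assumes Z: "Z \<in> cartan_domain"
  shows "det (mat 1 - Z ** conj_transpose Z) \<noteq> 0"
proof
  assume "det (mat 1 - Z ** conj_transpose Z) = 0"
  then obtain x where x: "x \<noteq> 0" "(mat 1 - Z ** conj_transpose Z) *v x = 0"
    by (metis invertible_det_nz invertible_left_inverse matrix_left_invertible_ker)
  define y where "y = conj_transpose Z *v x"
  (* A kernel vector x of 1 - Z Z* and y = Z* x satisfy |x| = |y|, contradicting |Z y| < |y|. *)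
  have xy: "x = Z *v y"
    using x(2) by (simp add: y_def matrix_vector_mult_diff_rdistrib matrix_vector_mul_assoc)
  then have "y \<noteq> 0" using x(1) by auto
  then have lt: "norm x < norm y" using Z xy by (auto simp: cartan_domain_iff)
  have "herm x x = herm y y"
    using herm_adjoint[of x Z y] by (simp add: xy[symmetric] y_def[symmetric])
  then have "(norm x)\<^sup>2 = (norm y)\<^sup>2" by (simp add: herm_self flip: of_real_power)
  then show False using lt by simp
qed

lemma gram_det_real: "det (mat 1 - Z ** conj_transpose Z) = of_real (gram_det Z)"
proof -
  have "conj_transpose (mat 1 - Z ** conj_transpose Z) = mat 1 - Z ** conj_transpose Z"
    by (simp add: conj_transpose_diff conj_transpose_mult)
  then have "cnj (det (mat 1 - Z ** conj_transpose Z)) = det (mat 1 - Z ** conj_transpose Z)"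
    by (metis det_conj_transpose)
  then show ?thesis unfolding gram_det_def by (metis Reals_cnj_iff of_real_Re)
qed

lemma gram_det_pos:
  fixes Z :: "complex^'n^'n"
  assumes Z: "Z \<in> cartan_domain" shows "gram_det Z > 0"
proof (rule ccontr)
  assume neg: "\<not> gram_det Z > 0"
  (* Along the segment from 0 to Z the determinant starts at 1 and never vanishes. *)
  have "continuous_on {0..1} (\<lambda>t::real. gram_det (t *\<^sub>R Z))"
    by (intro continuous_intros)
  moreover have "gram_det (0 *\<^sub>R Z) = 1" by (simp add: gram_det_def conj_transpose_def matrix_matrix_mult_def mat_def[symmetric] zero_vec_def[symmetric])
  ultimately obtain t where t: "0 \<le> t" "t \<le> 1" "gram_det (t *\<^sub>R Z) = 0"
    using neg IVT2'[of "\<lambda>t. gram_det (t *\<^sub>R Z)" 1 0 0] by auto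
  have "t *\<^sub>R Z = diag (\<lambda>_. of_real t) ** Z"
    by (simp add: vec_eq_iff) (simp add: scaleR_conv_of_real)
  then have "t *\<^sub>R Z \<in> cartan_domain"
    using cartan_domain_diag(1)[OF Z, of "\<lambda>_. of_real t"] t by simp
  then have "gram_det (t *\<^sub>R Z) \<noteq> 0"
    using det_gram_nonzero gram_det_real by (metis of_real_0)
  with t show False by simp
qed

text \<open>Both scalings conjugate \<open>1 - Z Z\<^sup>*\<close> by a unitary matrix or leave it unchanged.\<close>

lemma gram_det_unitary_diag:
  assumes "\<And>i. cmod (d i) = 1"
  shows "gram_det (diag d ** Z) = gram_det Z" "gram_det (Z ** diag d) = gram_det Z"
proof -
  have dd: "diag d ** diag (\<lambda>i. cnj (d i)) = mat 1"
    by (simp add: diag_mult_diag complex_norm_square[symmetric] assms flip: diag_one)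
  have "mat 1 - (diag d ** Z) ** conj_transpose (diag d ** Z)
     = diag d ** (mat 1 - Z ** conj_transpose Z) ** diag (\<lambda>i. cnj (d i))"
    by (simp add: conj_transpose_mult conj_transpose_diag matrix_mult_diff_left matrix_mult_diff_right dd matrix_mul_assoc)
  then have "det (mat 1 - (diag d ** Z) ** conj_transpose (diag d ** Z))
     = det (diag d) * det (diag (\<lambda>i. cnj (d i))) * det (mat 1 - Z ** conj_transpose Z)"
    by (simp only: det_mul mult_ac)
  also have "det (diag d) * det (diag (\<lambda>i. cnj (d i))) = 1"
    by (metis dd det_I det_mul)
  finally show "gram_det (diag d ** Z) = gram_det Z"
    by (simp add: gram_det_def)
  have "(Z ** diag d) ** conj_transpose (Z ** diag d) = Z ** (diag d ** diag (\<lambda>i. cnj (d i))) ** conj_transpose Z"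
    by (simp add: conj_transpose_mult conj_transpose_diag matrix_mul_assoc)
  then show "gram_det (Z ** diag d) = gram_det Z"
    by (simp add: gram_det_def dd)
qed

text \<open>With \<open>M = Z Z\<^sup>*\<close> the scaled matrix is \<open>1 - R M R\<close> for the diagonal matrix \<open>R\<close> with entry \<open>r\<close> at
  position \<open>j\<close>. Linearity of the determinant in row \<open>j\<close> gives one summand that does not depend on
  \<open>r\<close> and one of the form \<open>det (R B R)\<close>. So the determinant is affine in \<open>r\<^sup>2\<close>, which turns its
  singular behaviour at the boundary into that of a power of one real variable.\<close>

lemma gram_det_row_scale:
  fixes Z :: "complex^'n^'n" and j :: 'n
  shows "\<exists>b. \<forall>r. gram_det (diag (\<lambda>i. if i = j then of_real r else 1) ** Z)
    = gram_det (diag (\<lambda>i. if i = j then 0 else 1) ** Z) - r\<^sup>2 * b"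
proof -
  define M where "M = Z ** conj_transpose Z"
  define \<rho> where "\<rho> r k = (if k = j then of_real r else (1::complex))" for r k
  define a where "a = (\<chi> k. if k = j then (1::complex) else 0)"
  define b where "b r = (\<chi> k. - of_real r * M $ j $ k * \<rho> r k)" for r
  define c where "c r i = (\<chi> k. (if i = k then 1 else 0) - M $ i $ k * \<rho> r k)" for r i
  define A where "A r = (\<chi> i. if i = j then a else c r i)" for r
  define B where "B r = (\<chi> i. if i = j then b r else c r i)" for r
  have N: "mat 1 - (diag (\<rho> r) ** Z) ** conj_transpose (diag (\<rho> r) ** Z)
      = (\<chi> i. if i = j then a + b r else c r i)" for r
  proof -
    have "(diag (\<rho> r) ** Z) ** conj_transpose (diag (\<rho> r) ** Z) = diag (\<rho> r) ** M ** diag (\<rho> r)"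
    proof -
      have "(\<lambda>i. cnj (\<rho> r i)) = \<rho> r" by (auto simp: \<rho>_def)
      then show ?thesis by (simp add: M_def conj_transpose_mult conj_transpose_diag matrix_mul_assoc)
    qed
    then show ?thesis
      by (auto simp: vec_eq_iff mat_def a_def b_def c_def \<rho>_def)
  qed
  (* Row j is split as a unit vector plus a multiple of r. *)
  have split: "det (mat 1 - (diag (\<rho> r) ** Z) ** conj_transpose (diag (\<rho> r) ** Z)) = det (A r) + det (B r)" for r
    unfolding N A_def B_def by (rule det_row_add[where a="\<lambda>_. a" and b="\<lambda>_. b r"])
  have A: "det (A r) = det (A 0)" for r
    unfolding det_def
  proof (rule sum.cong, simp)
    fix p assume "p \<in> {p. p permutes (UNIV::'n set)}"
    then have p: "inj p" by (auto simp: permutes_inj)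
    (* Only permutations fixing j contribute, and these avoid all other entries of column j,
       the only ones that depend on r. *)
    have "(\<Prod>i\<in>UNIV. A r $ i $ p i) = (\<Prod>i\<in>UNIV. A 0 $ i $ p i)"
    proof (cases "p j = j")
      case True
      then have "p i \<noteq> j" if "i \<noteq> j" for i using p that by (metis injD)
      then show ?thesis by (intro prod.cong) (auto simp: A_def c_def \<rho>_def)
    next
      case False
      then have "A r $ j $ p j = 0" "A 0 $ j $ p j = 0" by (auto simp: A_def a_def)
      then show ?thesis by (metis (no_types, lifting) UNIV_I finite prod_zero)
    qed
    then show "of_int (sign p) * (\<Prod>i\<in>UNIV. A r $ i $ p i) = of_int (sign p) * (\<Prod>i\<in>UNIV. A 0 $ i $ p i)"
      by simp
  qed
  have "B r = diag (\<rho> r) ** B 1 ** diag (\<rho> r)" for r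
    by (auto simp: vec_eq_iff B_def b_def c_def \<rho>_def)
  moreover have "det (diag (\<rho> r)) = of_real r" for r
    by (subst det_diagonal) (auto simp: diag_def \<rho>_def prod.If_cases)
  ultimately have B: "det (B r) = of_real (r\<^sup>2) * det (B 1)" for r
    by (metis det_mul mult.assoc mult.commute of_real_mult power2_eq_square)
  have g: "gram_det (diag (\<rho> r) ** Z) = Re (det (A 0)) + r\<^sup>2 * Re (det (B 1))" for r
    unfolding gram_det_def split A[of r] B[of r] by simp
  have "gram_det (diag (\<rho> r) ** Z) = gram_det (diag (\<rho> 0) ** Z) - r\<^sup>2 * (- Re (det (B 1)))" for r
    using g[of r] g[of 0] by simp
  then show ?thesis unfolding \<rho>_def by (intro exI[of _ "- Re (det (B 1))"]) (simp cong: if_cong)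
qed

section \<open>Integrability of the weight\<close>

lemma linear_diag_mult:
  "linear (\<lambda>Z::complex^'n^'n. diag d ** Z)" "linear (\<lambda>Z::complex^'n^'n. Z ** diag d)"
  by (rule linearI; simp add: vec_eq_iff algebra_simps)+

lemma norm_matrix_sq: "(norm Z)\<^sup>2 = (\<Sum>i\<in>UNIV. \<Sum>j\<in>UNIV. (cmod (Z $ i $ j))\<^sup>2)"
  for Z :: "complex^'n^'m"
  by (simp only: norm_vector_sq)

lemma norm_unitary_diag:
  fixes Z :: "complex^'n^'n"
  assumes "\<And>i. cmod (d i) = 1"
  shows "norm (diag d ** Z) = norm Z" "norm (Z ** diag d) = norm Z"
proof -
  have "(norm (diag d ** Z))\<^sup>2 = (norm Z)\<^sup>2" "(norm (Z ** diag d))\<^sup>2 = (norm Z)\<^sup>2"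
    unfolding norm_matrix_sq by (simp_all add: norm_mult assms)
  then show "norm (diag d ** Z) = norm Z" "norm (Z ** diag d) = norm Z"
    by simp_all
qed

lemma continuous_on_linear_comp:
  fixes S :: "'a::euclidean_space \<Rightarrow> 'b::real_normed_vector"
  assumes "linear S" shows "continuous_on A S"
  using assms by (simp add: linear_continuous_on linear_linear)

text \<open>The exact Jacobian of scaling one row by \<open>r\<close> is a power of \<open>r\<close>; only a bound that is uniform for
  \<open>1 \<le> r \<le> 2\<close> matters.\<close>

lemma nn_integral_row_scale_le:
  fixes F :: "complex^'n^'n \<Rightarrow> ennreal"
  assumes [measurable]: "F \<in> borel_measurable borel" and r: "1 \<le> r" "r \<le> 2"
  shows "(\<integral>\<^sup>+Z. F Z \<partial>lborel) \<le>
    ennreal (2 ^ DIM(complex^'n^'n)) * (\<integral>\<^sup>+Z. F (diag (\<lambda>i. if i = j then of_real r else 1) ** Z) \<partial>lborel)"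
proof -
  define S where "S Z = diag (\<lambda>i. if i = j then of_real r else 1) ** Z" for Z :: "complex^'n^'n"
  define c where "c b = (if b $ j = 0 then 1 else r)" for b :: "complex^'n^'n"
  have "(\<integral>\<^sup>+Z. F Z \<partial>lborel) = ennreal (\<Prod>b\<in>Basis. \<bar>c b\<bar>) * (\<integral>\<^sup>+Z. F (S Z) \<partial>lborel)"
  proof (rule nn_integral_lborel_diagonal)
    show "linear S" unfolding S_def by (rule linear_diag_mult)
    fix b :: "complex^'n^'n" assume "b \<in> Basis"
    then obtain i v where b: "b = axis i v" "v \<in> Basis"
      by (auto simp: Basis_vec_def)
    have "v \<noteq> 0" using b(2) nonzero_Basis by blast
    then show "S b = c b *\<^sub>R b"
      unfolding b(1) S_def c_def
      by (auto simp: vec_eq_iff axis_def) (simp_all add: scaleR_conv_of_real)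
    show "c b \<noteq> 0" using r by (simp add: c_def)
  qed simp
  also have "(\<Prod>b\<in>(Basis::(complex^'n^'n) set). \<bar>c b\<bar>) \<le> (\<Prod>b\<in>(Basis::(complex^'n^'n) set). 2)"
    by (rule prod_mono) (use r in \<open>auto simp: c_def\<close>)
  then have "ennreal (\<Prod>b\<in>Basis. \<bar>c b\<bar>) * (\<integral>\<^sup>+Z. F (S Z) \<partial>lborel)
    \<le> ennreal (2 ^ DIM(complex^'n^'n)) * (\<integral>\<^sup>+Z. F (S Z) \<partial>lborel)"
    by (intro mult_right_mono ennreal_leI) auto
  finally show ?thesis by (simp add: S_def)
qed

lemma borel_measurable_gram_det [measurable]: "gram_det \<in> borel_measurable borel"
  by (intro borel_measurable_continuous_onI continuous_intros)

lemma sets_cartan_domain [measurable, simp]: "cartan_domain \<in> sets borel"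
  by (simp add: open_cartan_domain)

lemma emeasure_cartan_domain_finite: "emeasure lborel (cartan_domain :: (complex^'n^'n) set) < top"
proof -
  obtain B where "(cartan_domain :: (complex^'n^'n) set) \<subseteq> cball 0 B"
    using bounded_cartan_domain unfolding bounded_iff by (auto simp: subset_iff)
  then have "emeasure lborel (cartan_domain :: (complex^'n^'n) set) \<le> emeasure lborel (cball (0::complex^'n^'n) B)"
    by (intro emeasure_mono) auto
  also have "\<dots> < top" using emeasure_lborel_cball_finite[of "0::complex^'n^'n" B] by simp
  finally show ?thesis .
qed

text \<open>Rows outside \<open>J\<close> are replaced by zero. The result keeps the size of the matrix, so that an induction
  over the number of rows stays within one type.\<close>

definition row_proj :: "'n set \<Rightarrow> complex^'n^'n \<Rightarrow> complex^'n^'n" where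
  "row_proj J Z = diag (\<lambda>i. if i \<in> J then 1 else 0) ** Z"

lemma borel_measurable_row_proj [measurable]: "row_proj J \<in> borel_measurable borel"
  unfolding row_proj_def
  by (intro borel_measurable_continuous_onI continuous_on_linear_comp linear_diag_mult)

lemma row_proj_cartan_domain: "Z \<in> cartan_domain \<Longrightarrow> row_proj J Z \<in> cartan_domain"
  unfolding row_proj_def by (intro cartan_domain_diag) auto

text \<open>Let \<open>A\<close> be the determinant of the rows in \<open>J\<close>. After scaling row \<open>j\<close> by \<open>1 / sqrt x\<close> the determinant
  of the rows in \<open>insert j J\<close> is \<open>A (x - q) / x\<close>, because it is affine in \<open>1 / x\<close> and tends to \<open>A\<close>
  for large \<open>x\<close>. Raising \<open>1 / x \<ge> 1\<close> to a negative power gives a factor of at most 1.\<close>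

lemma gram_det_powr_row_step:
  fixes Z :: "complex^'n^'n"
  assumes s: "s < 0" and j: "j \<notin> J"
  shows "\<exists>q. \<forall>x\<in>{1/4..1}.
    (indicator cartan_domain (diag (\<lambda>i. if i = j then of_real (1 / sqrt x) else 1) ** Z) :: ennreal) *
      ennreal (gram_det (row_proj (insert j J) (diag (\<lambda>i. if i = j then of_real (1 / sqrt x) else 1) ** Z)) powr s)
    \<le> indicator cartan_domain Z * ennreal (gram_det (row_proj J Z) powr s) * (if q < x then ennreal ((x - q) powr s) else 0)"
proof -
  define S where "S r = diag (\<lambda>i. if i = j then of_real r else 1) ** Z" for r
  define A where "A = gram_det (row_proj J Z)"
  obtain b where b: "\<And>r. gram_det (diag (\<lambda>i. if i = j then of_real r else 1) ** row_proj (insert j J) Z)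
    = gram_det (diag (\<lambda>i. if i = j then 0 else 1) ** row_proj (insert j J) Z) - r\<^sup>2 * b"
    using gram_det_row_scale by metis
  have "diag (\<lambda>i. if i = j then of_real r else 1) ** row_proj (insert j J) Z = row_proj (insert j J) (S r)" for r
    by (simp add: vec_eq_iff row_proj_def S_def)
  moreover have "diag (\<lambda>i. if i = j then 0 else 1) ** row_proj (insert j J) Z = row_proj J Z"
    using j by (auto simp: vec_eq_iff row_proj_def)
  ultimately have g: "gram_det (row_proj (insert j J) (S r)) = A - r\<^sup>2 * b" for r
    using b unfolding A_def by metis
  show ?thesis
  proof (intro exI[of _ "b / A"] ballI, fold S_def)
    fix x :: real assume x: "x \<in> {1/4..1}"
    show "(indicator cartan_domain (S (1 / sqrt x)) :: ennreal) * ennreal (gram_det (row_proj (insert j J) (S (1 / sqrt x))) powr s)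
    \<le> indicator cartan_domain Z * ennreal (gram_det (row_proj J Z) powr s) * (if b / A < x then ennreal ((x - b / A) powr s) else 0)"
    proof (cases "S (1 / sqrt x) \<in> cartan_domain")
      case True
      (* Undoing the scaling is a contraction because x is at most 1, hence stays in the domain. *)
      have "diag (\<lambda>i. if i = j then of_real (sqrt x) else 1) ** S (1 / sqrt x) = Z"
        using x by (auto simp: vec_eq_iff S_def)
      moreover have "diag (\<lambda>i. if i = j then of_real (sqrt x) else 1) ** S (1 / sqrt x) \<in> cartan_domain"
        by (rule cartan_domain_diag(1)[OF True]) (use x in auto)
      ultimately have Z: "Z \<in> cartan_domain" by simp
      have A: "A > 0" unfolding A_def by (intro gram_det_pos row_proj_cartan_domain Z)
      have "gram_det (row_proj (insert j J) (S (1 / sqrt x))) > 0"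
        by (intro gram_det_pos row_proj_cartan_domain True)
      (* The determinant is affine in 1 / x, hence 1 / x times an affine function of x. *)
      moreover have gx: "gram_det (row_proj (insert j J) (S (1 / sqrt x))) = A * ((1 / x) * (x - b / A))"
        unfolding g using x A by (simp add: power_divide field_simps)
      ultimately have "0 < A * ((1 / x) * (x - b / A))" by simp
      then have q: "b / A < x" using A x by (simp add: zero_less_mult_iff zero_less_divide_iff)
      have "(1 / x) powr s \<le> 1"
        using powr_mono2'[of s 1 "1 / x"] x s by simp
      then have "gram_det (row_proj (insert j J) (S (1 / sqrt x))) powr s \<le> A powr s * (x - b / A) powr s"
        unfolding gx using A x q
        by (subst powr_mult; (subst powr_mult)?) (auto intro!: mult_left_mono mult_left_le_one_le)
      then show ?thesis using Z True q by (simp add: A_def[symmetric] ennreal_mult[symmetric] ennreal_leI)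
    qed simp
  qed
qed

text \<open>Induction over the rows. The integral is averaged over the scalings of the new row by \<open>1 / sqrt x\<close>,
  and by Fubini's theorem the average over \<open>x\<close> is taken first: by the preceding lemma it costs only
  a constant and removes the row from the determinant.\<close>

lemma nn_integral_gram_det_powr_row_proj_finite:
  fixes J :: "'n::finite set"
  assumes s: "-1 < s" "s < 0"
  shows "finite J \<Longrightarrow> (\<integral>\<^sup>+Z. indicator cartan_domain Z * ennreal (gram_det (row_proj J Z) powr s) \<partial>lborel) < top"
proof (induction J rule: finite_induct)
  case empty
  have "gram_det (row_proj {} Z) = 1" for Z :: "complex^'n^'n"
    by (simp add: row_proj_def gram_det_def)
       (simp add: diag_def matrix_matrix_mult_def mat_def[symmetric] zero_vec_def[symmetric])
  then show ?case by (simp add: emeasure_cartan_domain_finite)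
next
  case (insert j J)
  define F where "F Z = indicator cartan_domain Z * ennreal (gram_det (row_proj (insert j J) Z) powr s)" for Z :: "complex^'n^'n"
  define G where "G Z = indicator cartan_domain Z * ennreal (gram_det (row_proj J Z) powr s)" for Z :: "complex^'n^'n"
  define S where "S x Z = diag (\<lambda>i. if i = j then of_real (1 / sqrt x) else 1) ** Z" for x and Z :: "complex^'n^'n"
  define K where "K = ennreal (2 ^ DIM(complex^'n^'n))"
  have [measurable]: "F \<in> borel_measurable borel" unfolding F_def by measurable
  have [measurable]: "G \<in> borel_measurable borel" unfolding G_def by measurable
  have S_eq: "S x Z = Z + (1 / sqrt x - 1) *\<^sub>R row_proj {j} Z" for x Z
    by (auto simp: vec_eq_iff S_def row_proj_def) (simp add: scaleR_conv_of_real algebra_simps)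
  have [measurable]: "(\<lambda>(x, Z). S x Z) \<in> borel_measurable (borel \<Otimes>\<^sub>M borel)"
    unfolding S_eq by measurable
  obtain C where C: "C < top"
    "\<And>q. (\<integral>\<^sup>+x. indicator {1/4..1} x * (if q < x then ennreal ((x - q) powr s) else 0) \<partial>lborel) \<le> C"
    using nn_integral_powr_shift_bound[OF s] by blast
  (* 3/4 is the length of the interval of scaling parameters x; the factor 1 / sqrt x by which
     row j is multiplied then lies in [1, 2]. *)
  have "ennreal (3/4) * (\<integral>\<^sup>+Z. F Z \<partial>lborel) = (\<integral>\<^sup>+x. indicator {1/4..1::real} x * (\<integral>\<^sup>+Z. F Z \<partial>lborel) \<partial>lborel)"
    by (simp add: nn_integral_multc)
  also have "\<dots> \<le> (\<integral>\<^sup>+x. indicator {1/4..1::real} x * (K * (\<integral>\<^sup>+Z. F (S x Z) \<partial>lborel)) \<partial>lborel)"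
  proof (rule nn_integral_mono)
    fix x :: real
    have "(\<integral>\<^sup>+Z. F Z \<partial>lborel) \<le> K * (\<integral>\<^sup>+Z. F (S x Z) \<partial>lborel)" if x: "x \<in> {1/4..1}"
      unfolding K_def S_def
    proof (rule nn_integral_row_scale_le)
      have "sqrt (1/4) \<le> sqrt x" "sqrt x \<le> 1" using x by auto
      moreover have "sqrt (1/4) = 1/2" by (simp add: real_sqrt_divide)
      ultimately have "1/2 \<le> sqrt x" "sqrt x \<le> 1" by simp_all
      moreover have "1 \<le> 1 / y \<and> 1 / y \<le> 2" if "1/2 \<le> y" "y \<le> 1" for y :: real
        using that by (auto simp: field_simps)
      ultimately show "1 \<le> 1 / sqrt x" "1 / sqrt x \<le> 2" by blast+
    qed simp
    then show "indicator {1/4..1::real} x * (\<integral>\<^sup>+Z. F Z \<partial>lborel) \<le> indicator {1/4..1::real} x * (K * (\<integral>\<^sup>+Z. F (S x Z) \<partial>lborel))"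
      by (auto simp: indicator_def)
  qed
  also have "\<dots> = K * (\<integral>\<^sup>+x. (\<integral>\<^sup>+Z. indicator {1/4..1::real} x * F (S x Z) \<partial>lborel) \<partial>lborel)"
  proof -
    have [measurable]: "S x \<in> borel_measurable borel" for x
      unfolding S_def by (intro borel_measurable_continuous_onI continuous_on_linear_comp linear_diag_mult)
    have "indicator {1/4..1} x * (K * (\<integral>\<^sup>+Z. F (S x Z) \<partial>lborel))
        = K * (\<integral>\<^sup>+Z. indicator {1/4..1} x * F (S x Z) \<partial>lborel)" for x :: real
      by (subst nn_integral_cmult) (auto simp: mult.left_commute)
    then have "(\<integral>\<^sup>+x. indicator {1/4..1::real} x * (K * (\<integral>\<^sup>+Z. F (S x Z) \<partial>lborel)) \<partial>lborel)
        = (\<integral>\<^sup>+x. K * (\<integral>\<^sup>+Z. indicator {1/4..1::real} x * F (S x Z) \<partial>lborel) \<partial>lborel)"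
      by (intro nn_integral_cong)
    also have "\<dots> = K * (\<integral>\<^sup>+x. (\<integral>\<^sup>+Z. indicator {1/4..1::real} x * F (S x Z) \<partial>lborel) \<partial>lborel)"
      by (rule nn_integral_cmult) measurable
    finally show ?thesis .
  qed
  also have "(\<integral>\<^sup>+x. (\<integral>\<^sup>+Z. indicator {1/4..1::real} x * F (S x Z) \<partial>lborel) \<partial>lborel)
     = (\<integral>\<^sup>+Z. (\<integral>\<^sup>+x. indicator {1/4..1::real} x * F (S x Z) \<partial>lborel) \<partial>lborel)"
    by (rule lborel_pair.Fubini') measurable
  also have "\<dots> \<le> (\<integral>\<^sup>+Z. G Z * C \<partial>lborel)"
  proof (rule nn_integral_mono)
    fix Z :: "complex^'n^'n"
    obtain q where q: "\<And>x. x \<in> {1/4..1} \<Longrightarrow> F (S x Z) \<le> G Z * (if q < x then ennreal ((x - q) powr s) else 0)"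
      using gram_det_powr_row_step[OF s(2) insert(2), of Z] unfolding F_def G_def S_def by blast
    have "(\<integral>\<^sup>+x. indicator {1/4..1::real} x * F (S x Z) \<partial>lborel)
      \<le> (\<integral>\<^sup>+x. G Z * (indicator {1/4..1} x * (if q < x then ennreal ((x - q) powr s) else 0)) \<partial>lborel)"
    proof (rule nn_integral_mono)
      fix x :: real
      show "indicator {1/4..1} x * F (S x Z)
          \<le> G Z * (indicator {1/4..1} x * (if q < x then ennreal ((x - q) powr s) else 0))"
        using q[of x] by (cases "x \<in> {1/4..1}") simp_all
    qed
    also have "\<dots> = G Z * (\<integral>\<^sup>+x. indicator {1/4..1} x * (if q < x then ennreal ((x - q) powr s) else 0) \<partial>lborel)"
      by (rule nn_integral_cmult) measurable
    also have "\<dots> \<le> G Z * C" by (intro mult_left_mono C) simp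
    finally show "(\<integral>\<^sup>+x. indicator {1/4..1::real} x * F (S x Z) \<partial>lborel) \<le> G Z * C" .
  qed
  also have "\<dots> = (\<integral>\<^sup>+Z. G Z \<partial>lborel) * C" by (rule nn_integral_multc) measurable
  finally have "ennreal (3/4) * (\<integral>\<^sup>+Z. F Z \<partial>lborel) \<le> K * ((\<integral>\<^sup>+Z. G Z \<partial>lborel) * C)"
    by (simp add: mult_left_mono)
  moreover have "K * ((\<integral>\<^sup>+Z. G Z \<partial>lborel) * C) < top"
    using insert.IH C(1) by (simp add: K_def G_def ennreal_mult_less_top)
  ultimately have "ennreal (3/4) * (\<integral>\<^sup>+Z. F Z \<partial>lborel) < top" by (rule order_le_less_trans)
  then show ?case by (auto simp: F_def ennreal_mult_less_top)
qed

text \<open>For negative exponents this is the induction over the rows; otherwise the integrand is bounded on a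
  bounded set.\<close>

lemma nn_integral_gram_det_powr_finite:
  assumes s: "-1 < s"
  shows "(\<integral>\<^sup>+Z. indicator (cartan_domain :: (complex^'n^'n) set) Z * ennreal (gram_det Z powr s) \<partial>lborel) < top"
proof (cases "s < 0")
  case True
  have "row_proj UNIV Z = Z" for Z :: "complex^'n^'n"
    by (simp add: row_proj_def vec_eq_iff)
  then show ?thesis
    using nn_integral_gram_det_powr_row_proj_finite[OF s True, of "UNIV :: 'n set"] by simp
next
  case False
  have "compact (closure (cartan_domain :: (complex^'n^'n) set))"
    using bounded_cartan_domain by (simp add: compact_closure)
  then have "bounded (gram_det ` closure (cartan_domain :: (complex^'n^'n) set))"
    by (intro compact_imp_bounded compact_continuous_image continuous_intros)
  then obtain B where B: "\<And>Z::complex^'n^'n. Z \<in> cartan_domain \<Longrightarrow> \<bar>gram_det Z\<bar> \<le> B"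
    unfolding bounded_iff using closure_subset by fastforce
  have "(\<integral>\<^sup>+Z. indicator (cartan_domain :: (complex^'n^'n) set) Z * ennreal (gram_det Z powr s) \<partial>lborel)
    \<le> (\<integral>\<^sup>+Z. ennreal (B powr s) * indicator (cartan_domain :: (complex^'n^'n) set) Z \<partial>lborel)"
  proof (rule nn_integral_mono)
    fix Z :: "complex^'n^'n"
    have "gram_det Z powr s \<le> B powr s" if "Z \<in> cartan_domain"
      using gram_det_pos[OF that] B[OF that] False by (intro powr_mono2) auto
    then show "indicator cartan_domain Z * ennreal (gram_det Z powr s) \<le> ennreal (B powr s) * indicator cartan_domain Z"
      by (auto simp: indicator_def ennreal_leI)
  qed
  also have "\<dots> = ennreal (B powr s) * emeasure lborel (cartan_domain :: (complex^'n^'n) set)"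
    by (rule nn_integral_cmult_indicator) simp
  also have "\<dots> < top" by (simp add: emeasure_cartan_domain_finite ennreal_mult_less_top)
  finally show ?thesis .
qed

section \<open>The Bergman measure\<close>

lemma weight_eq: "weight lam Z = gram_det Z powr (lam - 2 * real CARD('n))" for Z :: "complex^'n^'n"
  by (simp add: weight_def gram_det_def)

lemma weight_pos: "Z \<in> cartan_domain \<Longrightarrow> weight lam Z > 0"
  using gram_det_pos[of Z] by (simp add: weight_eq)

lemma borel_measurable_weight [measurable]: "weight lam \<in> borel_measurable borel"
  unfolding weight_eq[abs_def] by measurable

lemma nn_integral_lebesgue_on_cartan_domain:
  assumes "F \<in> borel_measurable borel"
  shows "(\<integral>\<^sup>+Z. F Z \<partial>lebesgue_on cartan_domain) = (\<integral>\<^sup>+Z. indicator cartan_domain Z * F Z \<partial>lborel)"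
  using assms
  by (simp add: nn_integral_restrict_space sets_completionI_sub nn_integral_completion mult.commute)

lemma borel_measurable_lebesgue_on [measurable (raw)]:
  "F \<in> borel_measurable borel \<Longrightarrow> F \<in> borel_measurable (lebesgue_on S)"
  by (intro measurable_restrict_space1 measurable_completion) simp

lemma emeasure_lborel_open_nonzero:
  fixes U :: "'a::euclidean_space set"
  assumes "open U" "U \<noteq> {}"
  shows "emeasure lborel U \<noteq> 0"
  using open_not_negligible[OF assms] assms(1) by (simp add: negligible_iff_emeasure0)

text \<open>The total mass of the weight is finite and nonzero, so its reciprocal is the unique constant that
  the definite description asks for.\<close>

lemma norm_const_pos:
  assumes "lam > 2 * real CARD('n) - 1"
  shows "norm_const TYPE('n::finite) lam > 0"
proof -
  define I where "I = (\<integral>\<^sup>+Z. indicator cartan_domain Z * ennreal (weight lam (Z::complex^'n^'n)) \<partial>lborel)"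
  have "I < top" unfolding I_def weight_eq
    by (rule nn_integral_gram_det_powr_finite) (use assms in simp)
  moreover have "I \<noteq> 0"
  proof
    assume "I = 0"
    then have "AE Z::complex^'n^'n in lborel. indicator cartan_domain Z * ennreal (weight lam Z) = 0"
      unfolding I_def by (subst (asm) nn_integral_0_iff_AE) auto
    then have "AE Z::complex^'n^'n in lborel. Z \<notin> cartan_domain"
    proof eventually_elim
      case (elim Z)
      then show ?case using weight_pos[of Z lam] by (auto simp: indicator_def ennreal_eq_0_iff)
    qed
    then have "emeasure lborel (cartan_domain :: (complex^'n^'n) set) = 0"
      by (subst (asm) AE_iff_null) (auto simp: null_sets_def)
    then show False
      using emeasure_lborel_open_nonzero[OF open_cartan_domain] zero_in_cartan_domain by blast
  qed
  ultimately obtain i where i: "I = ennreal i" "i > 0"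
    by (cases I) (auto simp: ennreal_eq_0_iff not_le)
  have em: "emeasure (density (lebesgue_on cartan_domain) (\<lambda>Z :: complex^'n^'n. ennreal (c * weight lam Z))) cartan_domain
     = ennreal (c * i)" if "c > 0" for c
  proof -
    have "emeasure (density (lebesgue_on cartan_domain) (\<lambda>Z :: complex^'n^'n. ennreal (c * weight lam Z))) cartan_domain
      = (\<integral>\<^sup>+Z. ennreal (c * weight lam (Z::complex^'n^'n)) \<partial>lebesgue_on cartan_domain)"
      by (subst emeasure_density) (auto intro!: borel_measurable_lebesgue_on nn_integral_cong simp: sets_restrict_space indicator_def)
    also have "\<dots> = (\<integral>\<^sup>+Z. indicator cartan_domain Z * ennreal (c * weight lam (Z::complex^'n^'n)) \<partial>lborel)"
      by (rule nn_integral_lebesgue_on_cartan_domain) measurable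
    also have "\<dots> = (\<integral>\<^sup>+Z. ennreal c * (indicator cartan_domain Z * ennreal (weight lam (Z::complex^'n^'n))) \<partial>lborel)"
      using that by (intro nn_integral_cong) (auto simp: ennreal_mult indicator_def weight_def)
    also have "\<dots> = ennreal c * I" unfolding I_def by (rule nn_integral_cmult) measurable
    finally show ?thesis using that i by (simp add: ennreal_mult)
  qed
  let ?P = "\<lambda>c. c > 0 \<and> emeasure (density (lebesgue_on cartan_domain) (\<lambda>Z :: complex^'n^'n. ennreal (c * weight lam Z))) cartan_domain = 1"
  have "?P (1 / i)" using em[of "1 / i"] i by simp
  moreover have "c = 1 / i" if "?P c" for c
  proof -
    have "ennreal (c * i) = ennreal 1" using that em[of c] by simp
    then have "c * i = 1" using that i by (subst (asm) ennreal_inj) auto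
    then show ?thesis using i by (simp add: field_simps)
  qed
  ultimately show ?thesis
    unfolding norm_const_def by (rule theI2) auto
qed

text \<open>The Bergman measure as a measure on the Borel sets of the whole matrix space, which is the form in
  which Fubini's theorem and changes of variables apply. Borel functions have the same integrals with
  respect to both measures.\<close>

definition borel_bergman_measure :: "real \<Rightarrow> (complex^'n^'n) measure" where
  "borel_bergman_measure lam = density lborel (\<lambda>Z. indicator cartan_domain Z * ennreal (norm_const TYPE('n) lam * weight lam Z))"

lemma sets_borel_bergman_measure [simp, measurable_cong]: "sets (borel_bergman_measure lam) = sets borel"
  by (simp add: borel_bergman_measure_def)

lemma space_borel_bergman_measure [simp]: "space (borel_bergman_measure lam) = UNIV"
  by (simp add: borel_bergman_measure_def)

lemma nn_integral_borel_bergman_measure: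
  fixes F :: "complex^'n^'n \<Rightarrow> ennreal"
  assumes [measurable]: "F \<in> borel_measurable borel"
  shows "(\<integral>\<^sup>+Z. F Z \<partial>borel_bergman_measure lam) =
    (\<integral>\<^sup>+Z. indicator cartan_domain Z * ennreal (norm_const TYPE('n) lam * weight lam Z) * F Z \<partial>lborel)"
  unfolding borel_bergman_measure_def by (rule nn_integral_density) measurable

lemma measurable_bergman_id: "(\<lambda>Z. Z) \<in> measurable (bergman_measure lam) (borel_bergman_measure lam)"
proof -
  have "(\<lambda>Z::complex^'n^'n. Z) \<in> measurable (lebesgue_on cartan_domain) borel"
    by (rule borel_measurable_lebesgue_on) simp
  then show ?thesis by (simp add: bergman_measure_def cong: measurable_cong_sets)
qed

lemma distr_bergman_measure:
  "distr (bergman_measure lam) (borel_bergman_measure lam) (\<lambda>Z. Z) = (borel_bergman_measure lam :: (complex^'n^'n) measure)"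
proof (rule measure_eqI)
  fix A assume "A \<in> sets (distr (bergman_measure lam) (borel_bergman_measure lam) (\<lambda>Z::complex^'n^'n. Z))"
  then have A [measurable]: "A \<in> sets borel" by simp
  let ?w = "\<lambda>Z::complex^'n^'n. ennreal (norm_const TYPE('n) lam * weight lam Z)"
  have "emeasure (distr (bergman_measure lam) (borel_bergman_measure lam) (\<lambda>Z. Z)) A
      = (\<integral>\<^sup>+Z. indicator A Z \<partial>distr (bergman_measure lam) (borel_bergman_measure lam) (\<lambda>Z. Z))"
    using A by (subst nn_integral_indicator) auto
  also have "\<dots> = (\<integral>\<^sup>+Z. indicator A Z \<partial>bergman_measure lam)"
    by (rule nn_integral_distr[OF measurable_bergman_id]) measurable
  also have "\<dots> = (\<integral>\<^sup>+Z. ?w Z * indicator A Z \<partial>lebesgue_on cartan_domain)"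
    unfolding bergman_measure_def
    by (rule nn_integral_density) (auto intro!: borel_measurable_lebesgue_on)
  also have "\<dots> = (\<integral>\<^sup>+Z. indicator cartan_domain Z * (?w Z * indicator A Z) \<partial>lborel)"
    by (rule nn_integral_lebesgue_on_cartan_domain) measurable
  also have "\<dots> = (\<integral>\<^sup>+Z. indicator A Z \<partial>borel_bergman_measure lam)"
    by (subst nn_integral_borel_bergman_measure) (auto simp: mult.assoc)
  also have "\<dots> = emeasure (borel_bergman_measure lam) A" using A by simp
  finally show "emeasure (distr (bergman_measure lam) (borel_bergman_measure lam) (\<lambda>Z. Z)) A = emeasure (borel_bergman_measure lam) A" .
qed simp

lemma integral_bergman_measure:
  fixes F :: "complex^'n^'n \<Rightarrow> 'b::{banach, second_countable_topology}"
  assumes "F \<in> borel_measurable borel"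
  shows "(\<integral>Z. F Z \<partial>bergman_measure lam) = (\<integral>Z. F Z \<partial>borel_bergman_measure lam)"
    and "integrable (bergman_measure lam) F \<longleftrightarrow> integrable (borel_bergman_measure lam) F"
proof -
  have F: "F \<in> borel_measurable (borel_bergman_measure lam)" using assms by (simp cong: measurable_cong_sets)
  show "(\<integral>Z. F Z \<partial>bergman_measure lam) = (\<integral>Z. F Z \<partial>borel_bergman_measure lam)"
    using integral_distr[OF measurable_bergman_id F] by (simp add: distr_bergman_measure)
  show "integrable (bergman_measure lam) F \<longleftrightarrow> integrable (borel_bergman_measure lam) F"
    using integrable_distr_eq[OF measurable_bergman_id F] by (simp add: distr_bergman_measure)
qed

lemma finite_measure_borel_bergman_measure:
  fixes lam :: real
  assumes "lam > 2 * real CARD('n) - 1"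
  shows "finite_measure (borel_bergman_measure lam :: (complex^'n^'n) measure)"
proof (rule finite_measureI)
  have "emeasure (borel_bergman_measure lam :: (complex^'n^'n) measure) (space (borel_bergman_measure lam)) = (\<integral>\<^sup>+Z. 1 \<partial>(borel_bergman_measure lam :: (complex^'n^'n) measure))"
    by simp
  also have "\<dots> = (\<integral>\<^sup>+Z. ennreal (norm_const TYPE('n) lam) * (indicator cartan_domain Z * ennreal (weight lam (Z::complex^'n^'n))) \<partial>lborel)"
    using norm_const_pos[OF assms]
    by (subst nn_integral_borel_bergman_measure) (auto intro!: nn_integral_cong simp: ennreal_mult indicator_def weight_def)
  also have "\<dots> = ennreal (norm_const TYPE('n) lam) * (\<integral>\<^sup>+Z. indicator cartan_domain Z * ennreal (weight lam (Z::complex^'n^'n)) \<partial>lborel)"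
    by (rule nn_integral_cmult) measurable
  also have "\<dots> < top"
    unfolding weight_eq
    by (intro ennreal_mult_less_top[THEN iffD2] disjI2 conjI nn_integral_gram_det_powr_finite) (use assms in auto)
  finally show "emeasure (borel_bergman_measure lam) (space (borel_bergman_measure lam :: (complex^'n^'n) measure)) \<noteq> \<infinity>" by simp
qed

lemma borel_bergman_measure_open_pos:
  fixes U :: "(complex^'n^'n) set"
  assumes lam: "lam > 2 * real CARD('n) - 1" and U: "open U" "U \<subseteq> cartan_domain"
    and AE: "AE Z in borel_bergman_measure lam. Z \<notin> U"
  shows "U = {}"
proof (rule ccontr)
  assume ne: "U \<noteq> {}"
  have pos: "0 < norm_const TYPE('n) lam * weight lam Z" if "Z \<in> U" for Z
    using that U(2) norm_const_pos[OF lam] weight_pos[of Z lam] by auto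
  have "AE Z in lborel. Z \<notin> U"
    using AE unfolding borel_bergman_measure_def
    by (subst (asm) AE_density) (use pos U(2) in \<open>auto elim!: eventually_mono simp: indicator_def subset_iff\<close>)
  then have "emeasure lborel U = 0"
    using U by (subst (asm) AE_iff_null) (auto simp: null_sets_def)
  then show False using emeasure_lborel_open_nonzero[OF U(1) ne] by simp
qed

text \<open>Multiplying rows or columns by unimodular numbers is a linear isometry that preserves the domain and
  the weight.\<close>

lemma nn_integral_borel_bergman_measure_diag:
  fixes F :: "complex^'n^'n \<Rightarrow> ennreal"
  assumes F [measurable]: "F \<in> borel_measurable borel" and d: "\<And>i. cmod (d i) = 1"
    and S: "S = (\<lambda>Z. diag d ** Z) \<or> S = (\<lambda>Z. Z ** diag d)"
  shows "(\<integral>\<^sup>+Z. F (S Z) \<partial>borel_bergman_measure lam) = (\<integral>\<^sup>+Z. F Z \<partial>borel_bergman_measure lam)"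
proof -
  have lin: "linear S" using S linear_diag_mult by blast
  then have [measurable]: "S \<in> borel_measurable borel"
    by (intro borel_measurable_continuous_onI continuous_on_linear_comp)
  have nrm: "norm (S Z) = norm Z" for Z using S norm_unitary_diag[of d Z] d by auto
  have w: "weight lam (S Z) = weight lam Z" for Z
    unfolding weight_eq using S gram_det_unitary_diag[of d Z] d by auto
  have D: "S Z \<in> cartan_domain \<longleftrightarrow> Z \<in> cartan_domain" for Z
  proof
    assume "Z \<in> cartan_domain"
    then show "S Z \<in> cartan_domain"
      using S cartan_domain_diag[of Z d] d by auto
  next
    assume SZ: "S Z \<in> cartan_domain"
    have dd: "diag (\<lambda>i. cnj (d i)) ** diag d = mat 1" "diag d ** diag (\<lambda>i. cnj (d i)) = mat 1"
      by (simp_all add: diag_mult_diag complex_norm_square[symmetric] mult.commute[of "cnj _"] d flip: diag_one)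
    have "diag (\<lambda>i. cnj (d i)) ** (diag d ** Z) = Z" "(Z ** diag d) ** diag (\<lambda>i. cnj (d i)) = Z"
      by (simp_all add: matrix_mul_assoc dd) (simp add: dd flip: matrix_mul_assoc)
    then show "Z \<in> cartan_domain"
      using S cartan_domain_diag[OF SZ, of "\<lambda>i. cnj (d i)"] d by auto
  qed
  define G where "G Z = indicator cartan_domain Z * ennreal (norm_const TYPE('n) lam * weight lam Z) * F Z" for Z
  have "(\<integral>\<^sup>+Z. F (S Z) \<partial>borel_bergman_measure lam) = (\<integral>\<^sup>+Z. G (S Z) \<partial>lborel)"
    unfolding G_def by (subst nn_integral_borel_bergman_measure) (auto simp: w D indicator_def)
  also have "\<dots> = (\<integral>\<^sup>+Z. G Z \<partial>lborel)"
    by (rule nn_integral_lborel_isometry[OF lin nrm]) (simp add: G_def)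
  also have "\<dots> = (\<integral>\<^sup>+Z. F Z \<partial>borel_bergman_measure lam)"
    unfolding G_def by (subst nn_integral_borel_bergman_measure) auto
  finally show ?thesis .
qed

lemma integral_borel_bergman_measure_diag:
  fixes F :: "complex^'n^'n \<Rightarrow> complex"
  assumes F [measurable]: "F \<in> borel_measurable borel" and d: "\<And>i. cmod (d i) = 1"
    and S: "S = (\<lambda>Z. diag d ** Z) \<or> S = (\<lambda>Z. Z ** diag d)"
  shows "(\<integral>Z. F (S Z) \<partial>borel_bergman_measure lam) = (\<integral>Z. F Z \<partial>borel_bergman_measure lam)"
proof -
  have lin: "linear S" using S linear_diag_mult by blast
  then have S' [measurable]: "S \<in> borel_measurable borel"
    by (intro borel_measurable_continuous_onI continuous_on_linear_comp)
  then have mS: "S \<in> measurable (borel_bergman_measure lam) (borel_bergman_measure lam)"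
    by (simp cong: measurable_cong_sets)
  have "distr (borel_bergman_measure lam) (borel_bergman_measure lam) S = borel_bergman_measure lam"
  proof (rule measure_eqI)
    fix A assume "A \<in> sets (distr (borel_bergman_measure lam) (borel_bergman_measure lam) S)"
    then have A [measurable]: "A \<in> sets borel" by simp
    have "emeasure (distr (borel_bergman_measure lam) (borel_bergman_measure lam) S) A = (\<integral>\<^sup>+Z. indicator A Z \<partial>distr (borel_bergman_measure lam) (borel_bergman_measure lam) S)"
      using A by (subst nn_integral_indicator) auto
    also have "\<dots> = (\<integral>\<^sup>+Z. indicator A (S Z) \<partial>borel_bergman_measure lam)"
      by (rule nn_integral_distr[OF mS]) measurable
    also have "\<dots> = (\<integral>\<^sup>+Z. indicator A Z \<partial>borel_bergman_measure lam)"
      by (rule nn_integral_borel_bergman_measure_diag[OF _ d S]) measurable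
    also have "\<dots> = emeasure (borel_bergman_measure lam) A" using A by simp
    finally show "emeasure (distr (borel_bergman_measure lam) (borel_bergman_measure lam) S) A = emeasure (borel_bergman_measure lam) A" .
  qed simp
  then show ?thesis
    using integral_distr[OF mS, of F] by (simp cong: measurable_cong_sets)
qed

section \<open>Holomorphic functions of a matrix\<close>

text \<open>Complex multiples of a matrix; \<open>*\<^sub>R\<close> has real scalars only.\<close>

definition cscale :: "complex \<Rightarrow> complex^'n^'n \<Rightarrow> complex^'n^'n" where
  "cscale z W = (\<chi> i j. z * W $ i $ j)"

lemma cscale_nth [simp]: "cscale z W $ i $ j = z * W $ i $ j"
  by (simp add: cscale_def)

lemma cscale_diag: "cscale z W = diag (\<lambda>_. z) ** W"
  by (simp add: vec_eq_iff)

lemma norm_cscale: "norm (cscale z W) = cmod z * norm W"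
proof -
  have "(norm (cscale z W))\<^sup>2 = (cmod z * norm W)\<^sup>2"
    unfolding norm_matrix_sq power_mult_distrib
    by (simp add: norm_mult power_mult_distrib sum_distrib_left)
  then show ?thesis by simp
qed

lemma cscale_eq: "cscale z W = Re z *\<^sub>R W + Im z *\<^sub>R cscale \<i> W"
  by (auto simp: vec_eq_iff complex_eq_iff)

lemma bounded_linear_cscale: "bounded_linear (\<lambda>z. cscale z W)"
  by (subst linear_conv_bounded_linear[symmetric], rule linearI)
     ((simp add: vec_eq_iff algebra_simps)+)

lemma continuous_on_cscale [continuous_intros]:
  "continuous_on A f \<Longrightarrow> continuous_on A (\<lambda>x. cscale (f x) W)"
  using bounded_linear.continuous_on[OF bounded_linear_cscale] .

lemma borel_measurable_cscale_i [measurable]: "cscale \<i> \<in> borel_measurable borel"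
  unfolding cscale_diag[abs_def]
  by (intro borel_measurable_continuous_onI continuous_on_linear_comp linear_diag_mult)

definition complex_deriv :: "(complex^'n^'n \<Rightarrow> complex) \<Rightarrow> (complex^'n^'n \<Rightarrow> complex) \<Rightarrow> complex^'n^'n \<Rightarrow> bool" where
  "complex_deriv f f' Z \<longleftrightarrow> (f has_derivative f') (at Z) \<and> (\<forall>c W. f' (cscale c W) = c * f' W)"

lemma holomorphic_on_matrices_iff:
  "holomorphic_on_matrices f S \<longleftrightarrow> (\<forall>Z\<in>S. \<exists>f'. complex_deriv f f' Z)"
  by (simp add: holomorphic_on_matrices_def complex_deriv_def cscale_def)

lemma complex_deriv_line:
  assumes "complex_deriv f f' (Z + cscale z W)"
  shows "((\<lambda>z. f (Z + cscale z W)) has_field_derivative f' W) (at z)"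
proof -
  have "((\<lambda>z. Z + cscale z W) has_derivative (\<lambda>h. 0 + cscale h W)) (at z)"
    by (intro has_derivative_add has_derivative_const bounded_linear_imp_has_derivative bounded_linear_cscale)
  moreover have "(f has_derivative f') (at (Z + cscale z W))"
    using assms by (simp add: complex_deriv_def)
  ultimately have "((\<lambda>z. f (Z + cscale z W)) has_derivative (\<lambda>h. f' (0 + cscale h W))) (at z)"
    by (rule has_derivative_compose)
  moreover have "(\<lambda>h. f' (0 + cscale h W)) = (*) (f' W)"
    using assms by (auto simp: complex_deriv_def mult.commute)
  ultimately show ?thesis by (simp add: has_field_derivative_def)
qed

lemma holomorphic_on_line:
  assumes "holomorphic_on_matrices f S" "open S"
  shows "(\<lambda>z. f (Z + cscale z W)) holomorphic_on {z. Z + cscale z W \<in> S}"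
    and "open {z. Z + cscale z W \<in> S}"
proof -
  show "(\<lambda>z. f (Z + cscale z W)) holomorphic_on {z. Z + cscale z W \<in> S}"
    unfolding holomorphic_on_def
  proof
    fix z assume "z \<in> {z. Z + cscale z W \<in> S}"
    then obtain f' where "complex_deriv f f' (Z + cscale z W)"
      using assms(1) by (auto simp: holomorphic_on_matrices_iff)
    from complex_deriv_line[OF this]
    show "(\<lambda>z. f (Z + cscale z W)) field_differentiable at z within {z. Z + cscale z W \<in> S}"
      using field_differentiable_at_within field_differentiable_def by blast
  qed
  have "continuous_on UNIV (\<lambda>z. Z + cscale z W)" by (intro continuous_intros)
  from open_vimage[OF assms(2) this] show "open {z. Z + cscale z W \<in> S}"
    by (simp add: vimage_def)
qed

lemma complex_deriv_bound:
  assumes f: "holomorphic_on_matrices f S" "open S" and d: "complex_deriv f f' Z"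
    and r: "r > 0" "cball Z r \<subseteq> S" and B: "\<And>W. W \<in> cball Z r \<Longrightarrow> cmod (f W) \<le> B"
  shows "cmod (f' h) \<le> B / r * norm h"
proof (cases "h = 0")
  case True
  have "f' 0 = 0" using d by (metis complex_deriv_def has_derivative_zero_unique has_derivative_linear linear_0)
  then show ?thesis using True by simp
next
  case False
  (* Cauchy's inequality on the complex line through Z in direction h, with the largest disc
     that stays in the ball. *)
  define \<delta> where "\<delta> = r / norm h"
  have \<delta>: "\<delta> > 0" using r False by (simp add: \<delta>_def)
  have in_ball: "Z + cscale z h \<in> cball Z r" if "cmod z \<le> \<delta>" for z
    using that False r by (simp add: dist_norm norm_cscale \<delta>_def field_simps)
  define \<phi> where "\<phi> z = f (Z + cscale z h)" for z
  have hol: "\<phi> holomorphic_on cball 0 \<delta>"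
    unfolding \<phi>_def
    by (rule holomorphic_on_subset[OF holomorphic_on_line(1)[OF f]]) (use in_ball r in auto)
  have "norm ((deriv ^^ 1) \<phi> 0) \<le> fact 1 * B / \<delta> ^ 1"
  proof (rule Cauchy_inequality)
    show "\<phi> holomorphic_on ball 0 \<delta>" using hol by (rule holomorphic_on_subset) auto
    show "continuous_on (cball 0 \<delta>) \<phi>" using hol by (rule holomorphic_on_imp_continuous_on)
    show "cmod (\<phi> x) \<le> B" if "cmod (0 - x) = \<delta>" for x
      unfolding \<phi>_def using that by (intro B in_ball) simp
  qed (fact \<delta>)
  moreover have "deriv \<phi> 0 = f' h"
  proof (rule DERIV_imp_deriv)
    have "Z + cscale 0 h = Z" by (simp add: vec_eq_iff)
    then show "(\<phi> has_field_derivative f' h) (at 0)"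
      unfolding \<phi>_def using d by (intro complex_deriv_line) simp
  qed
  ultimately show ?thesis using False r by (simp add: \<delta>_def field_simps)
qed

lemma sub_mean_value_circle:
  assumes f: "holomorphic_on_matrices f S" "open S" and r: "cball Z (norm W) \<subseteq> S"
  shows "ennreal ((cmod (f Z))\<^sup>2) \<le> (\<integral>\<^sup>+t. ennreal ((cmod (f (Z + cscale (rot t) W)))\<^sup>2) \<partial>angle_measure)"
proof -
  (* Squaring before averaging makes the triangle inequality for integrals suffice. *)
  define \<phi> where "\<phi> z = (f (Z + cscale z W))\<^sup>2" for z
  have hol: "\<phi> holomorphic_on {z. Z + cscale z W \<in> S}"
    unfolding \<phi>_def by (intro holomorphic_intros holomorphic_on_line f)
  have sub: "cball 0 1 \<subseteq> {z. Z + cscale z W \<in> S}"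
  proof
    fix z :: complex assume "z \<in> cball 0 1"
    then have "Z + cscale z W \<in> cball Z (norm W)"
      by (simp add: dist_norm norm_cscale mult_left_le_one_le)
    then show "z \<in> {z. Z + cscale z W \<in> S}" using r by auto
  qed
  note mv = circle_mean_value[OF holomorphic_on_line(2)[OF f] sub hol]
  have "Z + cscale 0 W = Z" by (simp add: vec_eq_iff)
  then have "(cmod (f Z))\<^sup>2 = norm (\<phi> 0)" by (simp add: \<phi>_def norm_power)
  then have "ennreal ((cmod (f Z))\<^sup>2) = ennreal (norm (\<integral>t. \<phi> (rot t) \<partial>angle_measure))" by (simp add: mv(2))
  also have "\<dots> \<le> (\<integral>\<^sup>+t. ennreal (norm (\<phi> (rot t))) \<partial>angle_measure)"
    by (rule integral_norm_bound_ennreal[OF mv(1)])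
  also have "\<dots> = (\<integral>\<^sup>+t. ennreal ((cmod (f (Z + cscale (rot t) W)))\<^sup>2) \<partial>angle_measure)"
    by (simp add: \<phi>_def norm_power)
  finally show ?thesis .
qed

lemma sets_borel_cball [measurable]: "cball (a::'a::metric_space) r \<in> sets borel"
  by simp

text \<open>The mean value inequality on the circles \<open>Z + rot t W\<close> is integrated over all \<open>W\<close> in a ball. For each
  angle the rotation of \<open>W\<close> is a linear isometry and disappears from the integral.\<close>

lemma sub_mean_value_ball:
  fixes f :: "complex^'n^'n \<Rightarrow> complex"
  assumes f: "holomorphic_on_matrices f S" "open S" and fm [measurable]: "f \<in> borel_measurable borel"
    and r: "cball Z r \<subseteq> S"
  shows "ennreal ((cmod (f Z))\<^sup>2) * emeasure lborel (cball (0::complex^'n^'n) r)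
    \<le> (\<integral>\<^sup>+W. indicator (cball Z r) W * ennreal ((cmod (f W))\<^sup>2) \<partial>lborel)"
proof -
  interpret T: finite_measure angle_measure by (rule finite_measure_angle_measure)
  interpret pair_sigma_finite "lborel :: (complex^'n^'n) measure" angle_measure ..
  let ?B = "indicator (cball (0::complex^'n^'n) r) :: _ \<Rightarrow> ennreal"
  have "ennreal ((cmod (f Z))\<^sup>2) * emeasure lborel (cball (0::complex^'n^'n) r)
      = (\<integral>\<^sup>+W. ennreal ((cmod (f Z))\<^sup>2) * ?B W \<partial>lborel)"
    by (subst nn_integral_cmult_indicator) auto
  also have "\<dots> \<le> (\<integral>\<^sup>+W. (\<integral>\<^sup>+t. ?B W * ennreal ((cmod (f (Z + cscale (rot t) W)))\<^sup>2) \<partial>angle_measure) \<partial>lborel)"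
  proof (rule nn_integral_mono)
    fix W :: "complex^'n^'n"
    show "ennreal ((cmod (f Z))\<^sup>2) * ?B W \<le> (\<integral>\<^sup>+t. ?B W * ennreal ((cmod (f (Z + cscale (rot t) W)))\<^sup>2) \<partial>angle_measure)"
    proof (cases "W \<in> cball 0 r")
      case True
      then have "cball Z (norm W) \<subseteq> S" using r by auto
      then show ?thesis using sub_mean_value_circle[OF f] True by simp
    qed simp
  qed
  also have "\<dots> = (\<integral>\<^sup>+t. (\<integral>\<^sup>+W. ?B W * ennreal ((cmod (f (Z + cscale (rot t) W)))\<^sup>2) \<partial>lborel) \<partial>angle_measure)"
  proof (rule Fubini'[symmetric])
    have [measurable]: "(\<lambda>t. Re (rot t)) \<in> borel_measurable angle_measure" "(\<lambda>t. Im (rot t)) \<in> borel_measurable angle_measure"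
      by (rule borel_measurable_continuous_on[OF _ rot_measurable], intro continuous_intros)+
    have [measurable]: "(\<lambda>(W, t). Z + (Re (rot t) *\<^sub>R W + Im (rot t) *\<^sub>R cscale \<i> W)) \<in> borel_measurable (lborel \<Otimes>\<^sub>M angle_measure)"
      by measurable
    show "(\<lambda>(W, t). ?B W * ennreal ((cmod (f (Z + cscale (rot t) W)))\<^sup>2)) \<in> borel_measurable (lborel \<Otimes>\<^sub>M angle_measure)"
      unfolding cscale_eq[of "rot _"] by measurable
  qed
  also have "\<dots> = (\<integral>\<^sup>+t. (\<integral>\<^sup>+W. indicator (cball Z r) W * ennreal ((cmod (f W))\<^sup>2) \<partial>lborel) \<partial>angle_measure)"
  proof (rule nn_integral_cong)
    fix t
    have "(\<integral>\<^sup>+W. ?B W * ennreal ((cmod (f (Z + cscale (rot t) W)))\<^sup>2) \<partial>lborel)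
        = (\<integral>\<^sup>+W. (\<lambda>V. ?B V * ennreal ((cmod (f (Z + V)))\<^sup>2)) (cscale (rot t) W) \<partial>lborel)"
      by (simp add: indicator_def norm_cscale)
    also have "\<dots> = (\<integral>\<^sup>+W. ?B W * ennreal ((cmod (f (Z + W)))\<^sup>2) \<partial>lborel)"
    proof (rule nn_integral_lborel_isometry)
      show "(\<lambda>V. ?B V * ennreal ((cmod (f (Z + V)))\<^sup>2)) \<in> borel_measurable borel" by measurable
    qed (auto simp: cscale_diag[abs_def] linear_diag_mult norm_unitary_diag)
    also have "\<dots> = (\<integral>\<^sup>+W. (\<lambda>V. indicator (cball Z r) V * ennreal ((cmod (f V))\<^sup>2)) (Z + 1 *\<^sub>R W) \<partial>lborel)"
      by (auto intro!: nn_integral_cong simp: indicator_def dist_norm)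
    also have "\<dots> = (\<integral>\<^sup>+W. indicator (cball Z r) W * ennreal ((cmod (f W))\<^sup>2) \<partial>lborel)"
    proof (rule nn_integral_lborel_reflect)
      show "(\<lambda>V. indicator (cball Z r) V * ennreal ((cmod (f V))\<^sup>2)) \<in> borel_measurable borel" by measurable
    qed simp
    finally show "(\<integral>\<^sup>+W. ?B W * ennreal ((cmod (f (Z + cscale (rot t) W)))\<^sup>2) \<partial>lborel)
       = (\<integral>\<^sup>+W. indicator (cball Z r) W * ennreal ((cmod (f W))\<^sup>2) \<partial>lborel)" .
  qed
  also have "\<dots> = (\<integral>\<^sup>+W. indicator (cball Z r) W * ennreal ((cmod (f W))\<^sup>2) \<partial>lborel)" by simp
  finally show ?thesis .
qed

section \<open>The Bergman space and its point evaluations\<close>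

lemma holomorphic_extension_measurable:
  fixes f :: "complex^'n^'n \<Rightarrow> complex"
  assumes "holomorphic_on_matrices f cartan_domain" "\<And>Z. Z \<notin> cartan_domain \<Longrightarrow> f Z = 0"
  shows "continuous_on cartan_domain f" "f \<in> borel_measurable borel"
proof -
  show c: "continuous_on cartan_domain f"
    using assms(1) unfolding holomorphic_on_matrices_iff complex_deriv_def
    by (meson continuous_at_imp_continuous_on has_derivative_continuous)
  have "(\<lambda>Z. indicator cartan_domain Z *\<^sub>R f Z) \<in> borel_measurable borel"
    by (rule borel_measurable_continuous_on_indicator[OF _ c]) simp
  also have "(\<lambda>Z. indicator cartan_domain Z *\<^sub>R f Z) = f"
    using assms(2) by (auto simp: indicator_def)
  finally show "f \<in> borel_measurable borel" .
qed

lemma sq_integrable_bergman_iff: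
  "sq_integrable (borel_bergman_measure lam) f \<longleftrightarrow> f \<in> borel_measurable borel \<and> integrable (borel_bergman_measure lam) (\<lambda>Z. (cmod (f Z))\<^sup>2)"
  by (simp add: sq_integrable_def cong: measurable_cong_sets)

lemma bergman_space_iff:
  "f \<in> bergman_space lam \<longleftrightarrow> sq_integrable (borel_bergman_measure lam) f \<and> holomorphic_on_matrices f cartan_domain \<and>
     (\<forall>Z. Z \<notin> cartan_domain \<longrightarrow> f Z = 0)"
proof (cases "holomorphic_on_matrices f cartan_domain \<and> (\<forall>Z. Z \<notin> cartan_domain \<longrightarrow> f Z = 0)")
  case True
  then have [measurable]: "f \<in> borel_measurable borel" using holomorphic_extension_measurable by blast
  then have "f \<in> borel_measurable (bergman_measure lam)"
    unfolding bergman_measure_def by (simp add: borel_measurable_lebesgue_on)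
  moreover have "(\<lambda>Z. (cmod (f Z))\<^sup>2) \<in> borel_measurable borel" by measurable
  ultimately show ?thesis using True
    unfolding bergman_space_def L2_def mem_Collect_eq sq_integrable_bergman_iff
    by (subst integral_bergman_measure(2)) auto
qed (auto simp: bergman_space_def)

lemma bergman_spaceD:
  assumes "f \<in> bergman_space lam"
  shows "sq_integrable (borel_bergman_measure lam) f" "holomorphic_on_matrices f cartan_domain"
    "\<And>Z. Z \<notin> cartan_domain \<Longrightarrow> f Z = 0" "f \<in> borel_measurable borel"
  using assms by (auto simp: bergman_space_iff sq_integrable_bergman_iff)

lemma bergman_space_add:
  assumes "f \<in> bergman_space lam" "g \<in> bergman_space lam"
  shows "(\<lambda>Z. f Z + g Z) \<in> bergman_space lam"
proof -
  have "holomorphic_on_matrices (\<lambda>Z. f Z + g Z) cartan_domain"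
    unfolding holomorphic_on_matrices_iff
  proof
    fix Z :: "complex^'a^'a" assume "Z \<in> cartan_domain"
    then obtain f' g' where "complex_deriv f f' Z" "complex_deriv g g' Z"
      using bergman_spaceD(2)[OF assms(1)] bergman_spaceD(2)[OF assms(2)]
      unfolding holomorphic_on_matrices_iff by blast
    then have "complex_deriv (\<lambda>Z. f Z + g Z) (\<lambda>h. f' h + g' h) Z"
      unfolding complex_deriv_def by (auto intro!: has_derivative_add simp: distrib_left)
    then show "\<exists>f'. complex_deriv (\<lambda>Z. f Z + g Z) f' Z" by blast
  qed
  then show ?thesis
    using assms by (auto simp: bergman_space_iff intro: sq_integrable_add)
qed

lemma bergman_space_cmult:
  assumes "f \<in> bergman_space lam"
  shows "(\<lambda>Z. c * f Z) \<in> bergman_space lam"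
proof -
  have "holomorphic_on_matrices (\<lambda>Z. c * f Z) cartan_domain"
    unfolding holomorphic_on_matrices_iff
  proof
    fix Z :: "complex^'a^'a" assume "Z \<in> cartan_domain"
    then obtain f' where "complex_deriv f f' Z"
      using bergman_spaceD(2)[OF assms(1)]
      unfolding holomorphic_on_matrices_iff by blast
    then have "complex_deriv (\<lambda>Z. c * f Z) (\<lambda>h. c * f' h) Z"
      unfolding complex_deriv_def by (auto intro!: has_derivative_mult_right)
    then show "\<exists>f'. complex_deriv (\<lambda>Z. c * f Z) f' Z" by blast
  qed
  then show ?thesis
    using assms by (auto simp: bergman_space_iff intro: sq_integrable_cmult)
qed

lemma bergman_space_diff:
  assumes "f \<in> bergman_space lam" "g \<in> bergman_space lam"
  shows "(\<lambda>Z. f Z - g Z) \<in> bergman_space lam"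
  using bergman_space_add[OF assms(1) bergman_space_cmult[OF assms(2), of "-1"]] by simp

lemma zero_in_bergman_space: "(\<lambda>Z. 0) \<in> bergman_space lam"
  unfolding bergman_space_iff holomorphic_on_matrices_iff
  by (auto simp: sq_integrable_bergman_iff complex_deriv_def intro!: exI[of _ "\<lambda>_. 0"])

text \<open>Near a point of the domain the weight is bounded below, so the mean value inequality on small balls
  bounds point evaluations by the norm of the Bergman space, locally uniformly.\<close>

lemma point_evaluation_bound:
  fixes Z0 :: "complex^'n^'n"
  assumes lam: "lam > 2 * real CARD('n) - 1" and Z0: "Z0 \<in> cartan_domain"
  shows "\<exists>\<rho>>0. \<exists>C\<ge>0. cball Z0 \<rho> \<subseteq> cartan_domain \<and>
    (\<forall>f\<in>bergman_space lam. \<forall>Z\<in>cball Z0 \<rho>. (cmod (f Z))\<^sup>2 \<le> C * (\<integral>W. (cmod (f W))\<^sup>2 \<partial>borel_bergman_measure lam))"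
proof -
  obtain R where R: "R > 0" "cball Z0 R \<subseteq> cartan_domain"
    using open_cartan_domain Z0 open_contains_cball by blast
  (* Balls of radius R / 2 about points of cball Z0 (R / 2) stay inside cball Z0 R. *)
  define \<rho> where "\<rho> = R / 2"
  have \<rho>: "\<rho> > 0" using R by (simp add: \<rho>_def)
  define c where "c = norm_const TYPE('n) lam"
  have c: "c > 0" unfolding c_def by (rule norm_const_pos[OF lam])
  have "continuous_on (cball Z0 R) (weight lam)"
    unfolding weight_eq[abs_def]
    by (intro continuous_intros) (use R gram_det_pos in force)
  then obtain Zm where Zm: "Zm \<in> cball Z0 R" "\<And>Z. Z \<in> cball Z0 R \<Longrightarrow> weight lam Zm \<le> weight lam Z"
    using continuous_attains_inf[of "cball Z0 R" "weight lam"] R by auto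
  define m where "m = weight lam Zm"
  have m: "m > 0" unfolding m_def using weight_pos Zm R by blast
  define V where "V = measure lborel (cball (0::complex^'n^'n) \<rho>)"
  have V: "emeasure lborel (cball (0::complex^'n^'n) \<rho>) = ennreal V" "V > 0"
  proof -
    show e: "emeasure lborel (cball (0::complex^'n^'n) \<rho>) = ennreal V"
      unfolding V_def using emeasure_lborel_cball_finite[of "0::complex^'n^'n" \<rho>]
      by (intro emeasure_eq_ennreal_measure) auto
    have "emeasure lborel (ball (0::complex^'n^'n) \<rho>) \<le> emeasure lborel (cball (0::complex^'n^'n) \<rho>)"
      by (intro emeasure_mono) auto
    moreover have "emeasure lborel (ball (0::complex^'n^'n) \<rho>) \<noteq> 0"
      using \<rho> by (intro emeasure_lborel_open_nonzero) auto
    ultimately have "emeasure lborel (cball (0::complex^'n^'n) \<rho>) \<noteq> 0" by auto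
    then show "V > 0" unfolding e by (simp add: ennreal_eq_0_iff)
  qed
  define C where "C = 1 / (c * m) / V"
  have "C \<ge> 0" using c m V by (auto simp: C_def)
  moreover have "cball Z0 \<rho> \<subseteq> cartan_domain" using R by (auto simp: \<rho>_def)
  moreover have "\<forall>f\<in>bergman_space lam. \<forall>Z\<in>cball Z0 \<rho>. (cmod (f Z))\<^sup>2 \<le> C * (\<integral>W. (cmod (f W))\<^sup>2 \<partial>borel_bergman_measure lam)"
  proof (intro ballI)
    fix f :: "complex^'n^'n \<Rightarrow> complex" and Z assume f: "f \<in> bergman_space lam" and Z: "Z \<in> cball Z0 \<rho>"
    note [measurable] = bergman_spaceD(4)[OF f]
    have sub: "cball Z \<rho> \<subseteq> cball Z0 R"
    proof
      fix W assume "W \<in> cball Z \<rho>"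
      then show "W \<in> cball Z0 R" using Z dist_triangle[of Z0 W Z] by (simp add: \<rho>_def)
    qed
    define N where "N = (\<integral>W. (cmod (f W))\<^sup>2 \<partial>borel_bergman_measure lam)"
    have "ennreal ((cmod (f Z))\<^sup>2 * V) = ennreal ((cmod (f Z))\<^sup>2) * emeasure lborel (cball (0::complex^'n^'n) \<rho>)"
      using V by (simp add: ennreal_mult)
    also have "\<dots> \<le> (\<integral>\<^sup>+W. indicator (cball Z \<rho>) W * ennreal ((cmod (f W))\<^sup>2) \<partial>lborel)"
      by (rule sub_mean_value_ball[OF bergman_spaceD(2)[OF f] open_cartan_domain]) (use sub R in auto)
    also have "\<dots> \<le> (\<integral>\<^sup>+W. ennreal (1 / (c * m)) * (indicator cartan_domain W * ennreal (c * weight lam W) * ennreal ((cmod (f W))\<^sup>2)) \<partial>lborel)"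
    proof (rule nn_integral_mono)
      fix W :: "complex^'n^'n"
      show "indicator (cball Z \<rho>) W * ennreal ((cmod (f W))\<^sup>2)
         \<le> ennreal (1 / (c * m)) * (indicator cartan_domain W * ennreal (c * weight lam W) * ennreal ((cmod (f W))\<^sup>2))"
      proof (cases "W \<in> cball Z \<rho>")
        case True
        then have W: "W \<in> cartan_domain" "m \<le> weight lam W" using sub R Zm(2) by (auto simp: m_def)
        have "1 \<le> 1 / (c * m) * (c * weight lam W)" using c m W(2) by (simp add: field_simps)
        then have "1 * (cmod (f W))\<^sup>2 \<le> 1 / (c * m) * (c * weight lam W) * (cmod (f W))\<^sup>2"
          by (intro mult_right_mono) auto
        then have "ennreal ((cmod (f W))\<^sup>2) \<le> ennreal (1 / (c * m) * (c * weight lam W) * (cmod (f W))\<^sup>2)"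
          by (intro ennreal_leI) simp
        also have "\<dots> = ennreal (1 / (c * m)) * (ennreal (c * weight lam W) * ennreal ((cmod (f W))\<^sup>2))"
          using c m W(2) by (simp add: ennreal_mult[symmetric] mult.assoc)
        finally show ?thesis using True W(1) by simp
      qed simp
    qed
    also have "\<dots> = ennreal (1 / (c * m)) * (\<integral>\<^sup>+W. ennreal ((cmod (f W))\<^sup>2) \<partial>borel_bergman_measure lam)"
      unfolding c_def by (subst nn_integral_borel_bergman_measure, simp) (rule nn_integral_cmult, measurable)
    also have "(\<integral>\<^sup>+W. ennreal ((cmod (f W))\<^sup>2) \<partial>borel_bergman_measure lam) = ennreal N"
      unfolding N_def using bergman_spaceD(1)[OF f] by (intro nn_integral_eq_integral) (auto simp: sq_integrable_def)
    also have "ennreal (1 / (c * m)) * ennreal N = ennreal (1 / (c * m) * N)"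
      using c m by (intro ennreal_mult[symmetric]) (auto simp: N_def)
    finally have "(cmod (f Z))\<^sup>2 * V \<le> 1 / (c * m) * N"
      using c m by (subst (asm) ennreal_le_iff) (auto simp: N_def)
    then have "(cmod (f Z))\<^sup>2 \<le> 1 / (c * m) * N / V"
      by (simp only: pos_le_divide_eq[OF V(2)])
    then show "(cmod (f Z))\<^sup>2 \<le> C * (\<integral>W. (cmod (f W))\<^sup>2 \<partial>borel_bergman_measure lam)"
      by (simp add: C_def N_def[symmetric] mult.commute)
  qed
  ultimately show ?thesis using \<rho> by blast
qed

section \<open>Completeness and the Bergman projection\<close>

text \<open>The point evaluation bound turns mean square convergence into locally uniform convergence, and
  Cauchy's estimates make the derivatives converge locally uniformly too, so the limit is holomorphic.\<close>

lemma bergman_space_complete: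
  fixes g :: "nat \<Rightarrow> complex^'n^'n \<Rightarrow> complex"
  assumes lam: "lam > 2 * real CARD('n) - 1" and g: "\<And>k. g k \<in> bergman_space lam"
    and cauchy: "\<And>e. e > 0 \<Longrightarrow> \<exists>N. \<forall>k\<ge>N. \<forall>l\<ge>N. (\<integral>Z. (cmod (g k Z - g l Z))\<^sup>2 \<partial>borel_bergman_measure lam) < e"
  shows "\<exists>G\<in>bergman_space lam. \<forall>Z. (\<lambda>k. g k Z) \<longlonglongrightarrow> G Z"
proof -
  have unif: "\<exists>\<rho>>0. cball Z0 \<rho> \<subseteq> cartan_domain \<and>
      (\<forall>e>0. \<exists>N. \<forall>k\<ge>N. \<forall>l\<ge>N. \<forall>Z\<in>cball Z0 \<rho>. cmod (g k Z - g l Z) \<le> e)"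
    if Z0: "Z0 \<in> cartan_domain" for Z0
  proof -
    obtain \<rho> C where \<rho>: "\<rho> > 0" "C \<ge> 0" "cball Z0 \<rho> \<subseteq> cartan_domain"
      and C: "\<And>f Z. f \<in> bergman_space lam \<Longrightarrow> Z \<in> cball Z0 \<rho> \<Longrightarrow>
         (cmod (f Z))\<^sup>2 \<le> C * (\<integral>W. (cmod (f W))\<^sup>2 \<partial>borel_bergman_measure lam)"
      using point_evaluation_bound[OF lam Z0] by blast
    have "\<exists>N. \<forall>k\<ge>N. \<forall>l\<ge>N. \<forall>Z\<in>cball Z0 \<rho>. cmod (g k Z - g l Z) \<le> e" if e: "e > 0" for e
    proof -
      obtain N where N: "\<And>k l. k \<ge> N \<Longrightarrow> l \<ge> N \<Longrightarrow> (\<integral>Z. (cmod (g k Z - g l Z))\<^sup>2 \<partial>borel_bergman_measure lam) < e\<^sup>2 / (C + 1)"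
        using cauchy[of "e\<^sup>2 / (C + 1)"] e \<rho>(2) by (meson add_nonneg_pos divide_pos_pos zero_less_one zero_less_power)
      have "cmod (g k Z - g l Z) \<le> e" if "k \<ge> N" "l \<ge> N" "Z \<in> cball Z0 \<rho>" for k l Z
      proof -
        have "(cmod (g k Z - g l Z))\<^sup>2 \<le> C * (\<integral>W. (cmod (g k W - g l W))\<^sup>2 \<partial>borel_bergman_measure lam)"
          by (rule C[OF bergman_space_diff[OF g g] that(3)])
        also have "\<dots> \<le> C * (e\<^sup>2 / (C + 1))"
          using N[OF that(1,2)] \<rho>(2) by (intro mult_left_mono) auto
        also have "\<dots> \<le> e\<^sup>2" using \<rho>(2) e by (simp add: field_simps)
        finally show ?thesis by (rule power2_le_imp_le) (use e in simp)
      qed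
      then show ?thesis by blast
    qed
    then show ?thesis using \<rho> by blast
  qed
  have conv: "convergent (\<lambda>k. g k Z)" for Z
  proof (cases "Z \<in> cartan_domain")
    case True
    obtain \<rho> where \<rho>: "\<rho> > 0"
      "\<And>e. e > 0 \<Longrightarrow> \<exists>N. \<forall>k\<ge>N. \<forall>l\<ge>N. \<forall>W\<in>cball Z \<rho>. cmod (g k W - g l W) \<le> e"
      using unif[OF True] by blast
    have "Cauchy (\<lambda>k. g k Z)"
    proof (rule CauchyI)
      fix e :: real assume "e > 0"
      then obtain N where "\<forall>k\<ge>N. \<forall>l\<ge>N. \<forall>W\<in>cball Z \<rho>. cmod (g k W - g l W) \<le> e / 2"
        using \<rho>(2)[of "e / 2"] by auto
      moreover have "Z \<in> cball Z \<rho>" using \<rho>(1) by simp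
      ultimately have "\<forall>k\<ge>N. \<forall>l\<ge>N. cmod (g k Z - g l Z) \<le> e / 2" by blast
      moreover have "e / 2 < e" using \<open>e > 0\<close> by simp
      ultimately show "\<exists>N. \<forall>k\<ge>N. \<forall>l\<ge>N. norm (g k Z - g l Z) < e"
        using le_less_trans by blast
    qed
    then show ?thesis by (rule Cauchy_convergent)
  next
    case False
    then have "g k Z = 0" for k using bergman_spaceD(3)[OF g] by blast
    then show ?thesis by (simp add: convergent_const)
  qed
  define G where "G Z = lim (\<lambda>k. g k Z)" for Z
  have G: "(\<lambda>k. g k Z) \<longlonglongrightarrow> G Z" for Z
    using conv[of Z] by (simp add: G_def convergent_LIMSEQ_iff)
  have G0: "G Z = 0" if "Z \<notin> cartan_domain" for Z
  proof -
    have "g k Z = 0" for k using bergman_spaceD(3)[OF g that] .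
    then show ?thesis using G[of Z] by (simp add: LIMSEQ_const_iff)
  qed
  have "\<exists>G'. complex_deriv G G' Z0" if Z0: "Z0 \<in> cartan_domain" for Z0
  proof -
    obtain \<rho> where \<rho>: "\<rho> > 0" "cball Z0 \<rho> \<subseteq> cartan_domain"
      and un: "\<And>e. e > 0 \<Longrightarrow> \<exists>N. \<forall>k\<ge>N. \<forall>l\<ge>N. \<forall>W\<in>cball Z0 \<rho>. cmod (g k W - g l W) \<le> e"
      using unif[OF Z0] by blast
    define S where "S = ball Z0 (\<rho> / 2)"
    have near: "cball Z (\<rho> / 2) \<subseteq> cball Z0 \<rho>" if "Z \<in> S" for Z
    proof
      fix W assume "W \<in> cball Z (\<rho> / 2)"
      then show "W \<in> cball Z0 \<rho>" using that dist_triangle[of Z0 W Z] by (simp add: S_def)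
    qed
    have SD: "Z \<in> cartan_domain" if "Z \<in> S" for Z
    proof -
      have "Z \<in> cball Z (\<rho> / 2)" using \<rho>(1) by simp
      then show ?thesis using near[OF that] \<rho>(2) by blast
    qed
    define f' where "f' k Z = (SOME f'. complex_deriv (g k) f' Z)" for k Z
    have "\<exists>f'. complex_deriv (g k) f' Z" if "Z \<in> S" for k Z
      using bergman_spaceD(2)[OF g[of k]] SD[OF that] unfolding holomorphic_on_matrices_iff by blast
    then have f': "\<And>k Z. Z \<in> S \<Longrightarrow> complex_deriv (g k) (f' k Z) Z"
      unfolding f'_def by (rule someI_ex)
    (* By the Cauchy estimate the derivatives are uniformly Cauchy on the ball of half the radius. *)
    have fC: "\<exists>N. \<forall>k\<ge>N. \<forall>l\<ge>N. \<forall>Z\<in>S. \<forall>h. cmod (f' k Z h - f' l Z h) \<le> e * norm h" if e: "e > 0" for e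
    proof -
      have "e * (\<rho> / 2) > 0" using e \<rho> by simp
      then obtain N where N: "\<And>k l W. k \<ge> N \<Longrightarrow> l \<ge> N \<Longrightarrow> W \<in> cball Z0 \<rho> \<Longrightarrow> cmod (g k W - g l W) \<le> e * (\<rho> / 2)"
        using un[of "e * (\<rho> / 2)"] by blast
      have "cmod (f' k Z h - f' l Z h) \<le> e * norm h" if kl: "k \<ge> N" "l \<ge> N" and Z: "Z \<in> S" for k l Z h
      proof -
        have d: "complex_deriv (\<lambda>Z. g k Z - g l Z) (\<lambda>h. f' k Z h - f' l Z h) Z"
          using f'[OF Z, of k] f'[OF Z, of l] unfolding complex_deriv_def
          by (auto intro!: has_derivative_diff simp: right_diff_distrib)
        have "cmod (f' k Z h - f' l Z h) \<le> e * (\<rho> / 2) / (\<rho> / 2) * norm h"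
        proof (rule complex_deriv_bound[OF bergman_spaceD(2)[OF bergman_space_diff[OF g[of k] g[of l]]] open_cartan_domain d])
          show "0 < \<rho> / 2" using \<rho> by simp
          show "cball Z (\<rho> / 2) \<subseteq> cartan_domain" using near[OF Z] \<rho> by blast
          show "cmod (g k W - g l W) \<le> e * (\<rho> / 2)" if "W \<in> cball Z (\<rho> / 2)" for W
            using N[OF kl] near[OF Z] that by blast
        qed
        then show ?thesis using \<rho> by simp
      qed
      then show ?thesis by blast
    qed
    have f'conv: "convergent (\<lambda>k. f' k Z h)" if Z: "Z \<in> S" for Z h
    proof (rule Cauchy_convergent, rule CauchyI)
      fix e :: real assume e: "e > 0"
      have "e / (norm h + 1) > 0" using e by (simp add: add_nonneg_pos)
      then obtain N where N: "\<forall>k\<ge>N. \<forall>l\<ge>N. \<forall>Z\<in>S. \<forall>h'. cmod (f' k Z h' - f' l Z h') \<le> e / (norm h + 1) * norm h'"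
        using fC by blast
      have pos: "0 < norm h + 1" using norm_ge_zero[of h] by linarith
      have "e * norm h < e * (norm h + 1)" using e by simp
      then have "e * norm h / (norm h + 1) < e" using pos by (simp only: pos_divide_less_eq)
      then have less: "e / (norm h + 1) * norm h < e" by simp
      have "norm (f' k Z h - f' l Z h) < e" if "k \<ge> N" "l \<ge> N" for k l
        using N that Z le_less_trans[OF _ less] by blast
      then show "\<exists>N. \<forall>k\<ge>N. \<forall>l\<ge>N. norm (f' k Z h - f' l Z h) < e" by blast
    qed
    define g' where "g' Z h = lim (\<lambda>k. f' k Z h)" for Z h
    have g': "(\<lambda>k. f' k Z h) \<longlonglongrightarrow> g' Z h" if "Z \<in> S" for Z h
      using f'conv[OF that, of h] by (simp add: g'_def convergent_LIMSEQ_iff)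
    have unif': "\<forall>\<^sub>F k in sequentially. \<forall>Z\<in>S. \<forall>h. norm (f' k Z h - g' Z h) \<le> e * norm h" if e: "e > 0" for e
    proof -
      obtain N where N: "\<forall>k\<ge>N. \<forall>l\<ge>N. \<forall>Z\<in>S. \<forall>h. cmod (f' k Z h - f' l Z h) \<le> e * norm h"
        using fC[OF e] by blast
      show ?thesis
      proof (rule eventually_sequentiallyI[of N], intro ballI allI)
        fix k Z h assume k: "N \<le> k" and Z: "Z \<in> S"
        have "(\<lambda>l. norm (f' k Z h - f' l Z h)) \<longlonglongrightarrow> norm (f' k Z h - g' Z h)"
          by (intro tendsto_intros g' Z)
        then show "norm (f' k Z h - g' Z h) \<le> e * norm h"
          by (rule LIMSEQ_le_const2) (use N k Z in blast)
      qed
    qed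
    have Z0S: "Z0 \<in> S" using \<rho> by (simp add: S_def)
    have "\<exists>H. \<forall>Z\<in>S. (\<lambda>k. g k Z) \<longlonglongrightarrow> H Z \<and> (H has_derivative g' Z) (at Z within S)"
    proof (rule has_derivative_sequence[OF _ _ unif' Z0S G])
      show "convex S" by (simp add: S_def)
      show "(g k has_derivative f' k Z) (at Z within S)" if "Z \<in> S" for k Z
        using f'[OF that, of k] by (auto simp: complex_deriv_def intro: has_derivative_at_withinI)
    qed
    then obtain H where H: "\<And>Z. Z \<in> S \<Longrightarrow> (\<lambda>k. g k Z) \<longlonglongrightarrow> H Z"
      "\<And>Z. Z \<in> S \<Longrightarrow> (H has_derivative g' Z) (at Z within S)" by blast
    have "G Z = H Z" if "Z \<in> S" for Z using LIMSEQ_unique[OF G H(1)[OF that]] .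
    then have "(G has_derivative g' Z0) (at Z0 within S)"
      using H(2)[OF Z0S] Z0S by (metis has_derivative_transform)
    moreover have "at Z0 within S = at Z0"
      by (rule at_within_open[OF Z0S]) (simp add: S_def)
    ultimately have "(G has_derivative g' Z0) (at Z0)" by simp
    moreover have "g' Z0 (cscale c W) = c * g' Z0 W" for c W
    proof (rule LIMSEQ_unique[OF g'[OF Z0S]])
      have "f' k Z0 (cscale c W) = c * f' k Z0 W" for k
        using f'[OF Z0S, of k] by (simp add: complex_deriv_def)
      then show "(\<lambda>k. f' k Z0 (cscale c W)) \<longlonglongrightarrow> c * g' Z0 W"
        using tendsto_mult_left[OF g'[OF Z0S, of W], of c] by simp
    qed
    ultimately show ?thesis unfolding complex_deriv_def by blast
  qed
  then have hol: "holomorphic_on_matrices G cartan_domain"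
    unfolding holomorphic_on_matrices_iff by blast
  have "sq_integrable (borel_bergman_measure lam) G"
  proof (rule sq_integrable_L2_Cauchy_limit[of "borel_bergman_measure lam" g G])
    show "sq_integrable (borel_bergman_measure lam) (g k)" for k using bergman_spaceD(1)[OF g] .
    show "G \<in> borel_measurable (borel_bergman_measure lam)"
      using holomorphic_extension_measurable(2)[OF hol G0] by (simp cong: measurable_cong_sets)
  qed (use cauchy G in auto)
  then have "G \<in> bergman_space lam" unfolding bergman_space_iff using hol G0 by blast
  then show ?thesis using G by blast
qed

definition bergman_inner :: "real \<Rightarrow> (complex^'n^'n \<Rightarrow> complex) \<Rightarrow> (complex^'n^'n \<Rightarrow> complex) \<Rightarrow> complex" where
  "bergman_inner lam f g = (\<integral>Z. f Z * cnj (g Z) \<partial>borel_bergman_measure lam)"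

lemma L2_inner_eq_bergman_inner:
  assumes [measurable]: "f \<in> borel_measurable borel" "g \<in> borel_measurable borel"
  shows "L2_inner lam f g = bergman_inner lam f g"
  unfolding L2_inner_def bergman_inner_def by (rule integral_bergman_measure) measurable

lemma bergman_inner_diff_left:
  assumes "sq_integrable (borel_bergman_measure lam) f" "sq_integrable (borel_bergman_measure lam) g" "sq_integrable (borel_bergman_measure lam) h"
  shows "bergman_inner lam (\<lambda>Z. f Z - g Z) h = bergman_inner lam f h - bergman_inner lam g h"
  unfolding bergman_inner_def left_diff_distrib
  by (intro Bochner_Integration.integral_diff sq_integrable_integrable_mult assms)

lemma bergman_inner_cnj: "bergman_inner lam g f = cnj (bergman_inner lam f g)"
proof -
  have "(\<lambda>Z. g Z * cnj (f Z)) = (\<lambda>Z. cnj (f Z * cnj (g Z)))" by (simp add: mult.commute)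
  then show ?thesis unfolding bergman_inner_def by (simp only: Bochner_Integration.integral_cnj)
qed

lemma bergman_inner_self_eq_0:
  fixes u :: "complex^'n^'n \<Rightarrow> complex"
  assumes lam: "lam > 2 * real CARD('n) - 1" and u: "u \<in> bergman_space lam" and 0: "bergman_inner lam u u = 0"
  shows "u = (\<lambda>Z. 0)"
proof
  fix Z
  have "bergman_inner lam u u = of_real (\<integral>W. (cmod (u W))\<^sup>2 \<partial>borel_bergman_measure lam)"
    unfolding bergman_inner_def complex_norm_square[symmetric] by (rule integral_complex_of_real)
  then have n: "(\<integral>W. (cmod (u W))\<^sup>2 \<partial>borel_bergman_measure lam) = 0" using 0 by simp
  show "u Z = 0"
  proof (cases "Z \<in> cartan_domain")
    case True
    then obtain \<rho> C where \<rho>: "\<rho> > 0"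
      and C: "\<And>f W. f \<in> bergman_space lam \<Longrightarrow> W \<in> cball Z \<rho> \<Longrightarrow>
         (cmod (f W))\<^sup>2 \<le> C * (\<integral>W. (cmod (f W))\<^sup>2 \<partial>borel_bergman_measure lam)"
      using point_evaluation_bound[OF lam True] by blast
    have "(cmod (u Z))\<^sup>2 \<le> 0" using C[OF u, of Z] \<rho> n by simp
    then show ?thesis by simp
  next
    case False
    then show ?thesis using bergman_spaceD(3)[OF u] by blast
  qed
qed

lemma bergman_eqI:
  fixes u v :: "complex^'n^'n \<Rightarrow> complex"
  assumes lam: "lam > 2 * real CARD('n) - 1" and u: "u \<in> bergman_space lam" and v: "v \<in> bergman_space lam"
    and eq: "\<And>h. h \<in> bergman_space lam \<Longrightarrow> bergman_inner lam u h = bergman_inner lam v h"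
  shows "u = v"
proof -
  (* Test against h = u - v. *)
  have d: "(\<lambda>Z. u Z - v Z) \<in> bergman_space lam" by (rule bergman_space_diff[OF u v])
  have "bergman_inner lam (\<lambda>Z. u Z - v Z) (\<lambda>Z. u Z - v Z) = 0"
    using eq[OF d] by (subst bergman_inner_diff_left) (auto intro: bergman_spaceD u v d)
  from bergman_inner_self_eq_0[OF lam d this] show ?thesis by (metis eq_iff_diff_eq_0 ext)
qed

text \<open>Existence comes from the best approximation, uniqueness from the fact that an element of the Bergman
  space of norm zero vanishes at every point.\<close>

lemma bergman_projection:
  fixes F :: "complex^'n^'n \<Rightarrow> complex"
  assumes lam: "lam > 2 * real CARD('n) - 1" and F: "sq_integrable (borel_bergman_measure lam) F"
  shows "bergman_projection lam F \<in> bergman_space lam"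
    and "h \<in> bergman_space lam \<Longrightarrow> bergman_inner lam (bergman_projection lam F) h = bergman_inner lam F h"
proof -
  let ?P = "\<lambda>g. g \<in> bergman_space lam \<and> (\<forall>h\<in>bergman_space lam. L2_inner lam (\<lambda>Z. F Z - g Z) h = 0)"
  have Fm [measurable]: "F \<in> borel_measurable borel" using F by (simp add: sq_integrable_bergman_iff)
  have P_iff: "?P g \<longleftrightarrow> g \<in> bergman_space lam \<and> (\<forall>h\<in>bergman_space lam. bergman_inner lam g h = bergman_inner lam F h)" for g
  proof -
    have "L2_inner lam (\<lambda>Z. F Z - g Z) h = bergman_inner lam F h - bergman_inner lam g h"
      if "g \<in> bergman_space lam" "h \<in> bergman_space lam" for h
    proof -
      have [measurable]: "g \<in> borel_measurable borel" "h \<in> borel_measurable borel"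
        using that bergman_spaceD(4) by auto
      have "L2_inner lam (\<lambda>Z. F Z - g Z) h = bergman_inner lam (\<lambda>Z. F Z - g Z) h"
        by (rule L2_inner_eq_bergman_inner) measurable
      then show ?thesis using bergman_inner_diff_left[OF F bergman_spaceD(1)[OF that(1)] bergman_spaceD(1)[OF that(2)]] by simp
    qed
    then show ?thesis by auto
  qed
  have "\<exists>G\<in>bergman_space lam. \<forall>h\<in>bergman_space lam. (\<integral>Z. (F Z - G Z) * cnj (h Z) \<partial>borel_bergman_measure lam) = 0"
  proof (rule orthogonal_projection_exists)
    show "bergman_space lam \<noteq> {}" using zero_in_bergman_space by blast
    fix g :: "nat \<Rightarrow> complex^'n^'n \<Rightarrow> complex"
    assume "\<And>k. g k \<in> bergman_space lam"
      "\<And>e. e > 0 \<Longrightarrow> \<exists>N. \<forall>k\<ge>N. \<forall>l\<ge>N. (\<integral>Z. (cmod (g k Z - g l Z))\<^sup>2 \<partial>borel_bergman_measure lam) < e"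
    from bergman_space_complete[OF lam this]
    show "\<exists>G\<in>bergman_space lam. AE Z in borel_bergman_measure lam. (\<lambda>k. g k Z) \<longlonglongrightarrow> G Z" by auto
  qed (auto intro: bergman_spaceD(1) bergman_space_add bergman_space_cmult F)
  then obtain G where G: "G \<in> bergman_space lam" "\<And>h. h \<in> bergman_space lam \<Longrightarrow> bergman_inner lam (\<lambda>Z. F Z - G Z) h = 0"
    by (auto simp: bergman_inner_def)
  have PG: "?P G"
    unfolding P_iff using G bergman_inner_diff_left[OF F bergman_spaceD(1)[OF G(1)] bergman_spaceD(1)] by auto
  have "?P (bergman_projection lam F)"
    unfolding bergman_projection_def
  proof (rule theI[of ?P, OF PG])
    fix g assume "?P g"
    then have g: "g \<in> bergman_space lam" "\<And>h. h \<in> bergman_space lam \<Longrightarrow> bergman_inner lam g h = bergman_inner lam F h"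
      using P_iff[of g] by blast+
    have "\<And>h. h \<in> bergman_space lam \<Longrightarrow> bergman_inner lam G h = bergman_inner lam F h"
      using PG P_iff[of G] by blast
    then show "g = G" using g G(1) by (intro bergman_eqI[OF lam]) simp_all
  qed
  then have "bergman_projection lam F \<in> bergman_space lam \<and>
      (\<forall>h\<in>bergman_space lam. bergman_inner lam (bergman_projection lam F) h = bergman_inner lam F h)"
    unfolding P_iff .
  then show "bergman_projection lam F \<in> bergman_space lam"
    and "h \<in> bergman_space lam \<Longrightarrow> bergman_inner lam (bergman_projection lam F) h = bergman_inner lam F h"
    by blast+
qed

section \<open>Toeplitz operators that are not normal\<close>

lemma sq_integrable_symbol_mult:
  fixes a :: "complex^'n^'n \<Rightarrow> complex"
  assumes [measurable]: "a \<in> borel_measurable borel" and K: "\<And>Z. Z \<in> cartan_domain \<Longrightarrow> cmod (a Z) \<le> K"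
    and f: "f \<in> bergman_space lam"
  shows "sq_integrable (borel_bergman_measure lam) (\<lambda>Z. a Z * f Z)"
  unfolding sq_integrable_bergman_iff
proof
  have [measurable]: "f \<in> borel_measurable borel" using f by (rule bergman_spaceD)
  show "(\<lambda>Z. a Z * f Z) \<in> borel_measurable borel" by measurable
  show "integrable (borel_bergman_measure lam) (\<lambda>Z. (cmod (a Z * f Z))\<^sup>2)"
  proof (rule Bochner_Integration.integrable_bound)
    show "integrable (borel_bergman_measure lam) (\<lambda>Z. K\<^sup>2 * (cmod (f Z))\<^sup>2)"
      using bergman_spaceD(1)[OF f] by (simp add: sq_integrable_def)
    show "(\<lambda>Z. (cmod (a Z * f Z))\<^sup>2) \<in> borel_measurable (borel_bergman_measure lam)" by measurable
    have "(cmod (a Z * f Z))\<^sup>2 \<le> K\<^sup>2 * (cmod (f Z))\<^sup>2" for Z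
    proof (cases "Z \<in> cartan_domain")
      case True
      then show ?thesis
        using K[OF True] by (simp add: norm_mult power_mult_distrib mult_right_mono power_mono)
    next
      case False
      then have "f Z = 0" using bergman_spaceD(3)[OF f] by blast
      then show ?thesis by simp
    qed
    then show "AE Z in borel_bergman_measure lam. norm ((cmod (a Z * f Z))\<^sup>2) \<le> norm (K\<^sup>2 * (cmod (f Z))\<^sup>2)" by simp
  qed
qed

text \<open>The hypotheses say that \<open>f\<close> is in the kernel of the adjoint \<open>T\<^sup>*\<close>, which is the Toeplitz operator of
  the conjugate symbol, but not in the kernel of \<open>T\<close>. If \<open>T\<close> were normal, \<open>T\<^sup>* T f = T T\<^sup>* f = 0\<close>, and
  then the norm of \<open>T f\<close> would be zero.\<close>

lemma toeplitz_not_normalI: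
  fixes a :: "complex^'n^'n \<Rightarrow> complex"
  assumes lam: "lam > 2 * real CARD('n) - 1"
    and a: "a \<in> borel_measurable borel" and K: "\<And>Z. Z \<in> cartan_domain \<Longrightarrow> cmod (a Z) \<le> K"
    and f: "f \<in> bergman_space lam"
    and ker: "\<And>h. h \<in> bergman_space lam \<Longrightarrow> bergman_inner lam (\<lambda>Z. cnj (a Z) * f Z) h = 0"
    and h0: "h0 \<in> bergman_space lam" "bergman_inner lam (\<lambda>Z. a Z * f Z) h0 \<noteq> 0"
  shows "\<not> bergman_normal lam (toeplitz lam a)"
proof
  assume normal: "bergman_normal lam (toeplitz lam a)"
  have a' [measurable]: "(\<lambda>Z. cnj (a Z)) \<in> borel_measurable borel" using a by measurable
  have sq: "sq_integrable (borel_bergman_measure lam) (\<lambda>Z. a Z * u Z)" "sq_integrable (borel_bergman_measure lam) (\<lambda>Z. cnj (a Z) * u Z)"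
    if "u \<in> bergman_space lam" for u
  proof -
    show "sq_integrable (borel_bergman_measure lam) (\<lambda>Z. a Z * u Z)" by (rule sq_integrable_symbol_mult[OF a K that])
    show "sq_integrable (borel_bergman_measure lam) (\<lambda>Z. cnj (a Z) * u Z)"
      by (rule sq_integrable_symbol_mult[OF a' _ that, of K]) (use K in simp)
  qed
  have T: "toeplitz lam a u \<in> bergman_space lam"
      "h \<in> bergman_space lam \<Longrightarrow> bergman_inner lam (toeplitz lam a u) h = bergman_inner lam (\<lambda>Z. a Z * u Z) h"
    if "u \<in> bergman_space lam" for u h
    unfolding toeplitz_def by (rule bergman_projection[OF lam sq(1)[OF that]]; assumption)+
  define Ts where "Ts u = bergman_projection lam (\<lambda>Z. cnj (a Z) * u Z)" for u
  have Ts: "Ts u \<in> bergman_space lam"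
      "h \<in> bergman_space lam \<Longrightarrow> bergman_inner lam (Ts u) h = bergman_inner lam (\<lambda>Z. cnj (a Z) * u Z) h"
    if "u \<in> bergman_space lam" for u h
    unfolding Ts_def by (rule bergman_projection[OF lam sq(2)[OF that]]; assumption)+
  (* Multiplication by the conjugate symbol is the adjoint of multiplication by the symbol. *)
  have move: "bergman_inner lam (\<lambda>Z. a Z * u Z) v = cnj (bergman_inner lam (\<lambda>Z. cnj (a Z) * v Z) u)" for u v
  proof -
    have "bergman_inner lam (\<lambda>Z. cnj (a Z) * v Z) u = bergman_inner lam v (\<lambda>Z. a Z * u Z)"
      by (simp add: bergman_inner_def mult.assoc mult.left_commute)
    then show ?thesis using bergman_inner_cnj[of lam "\<lambda>Z. a Z * u Z" v] by simp
  qed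
  have adj: "bergman_adjoint lam (toeplitz lam a) u = Ts u" if u: "u \<in> bergman_space lam" for u
    unfolding bergman_adjoint_def
  proof (rule the_equality)
    have L: "L2_inner lam v w = bergman_inner lam v w" if "v \<in> bergman_space lam" "w \<in> bergman_space lam" for v w
      using that by (intro L2_inner_eq_bergman_inner bergman_spaceD(4))
    have main: "L2_inner lam (toeplitz lam a v) u = bergman_inner lam v (Ts u)" if v: "v \<in> bergman_space lam" for v
    proof -
      have "L2_inner lam (toeplitz lam a v) u = bergman_inner lam (\<lambda>Z. a Z * v Z) u"
        using L[OF T(1)[OF v] u] T(2)[OF v u] by simp
      also have "\<dots> = cnj (bergman_inner lam (Ts u) v)" using Ts(2)[OF u v] by (simp add: move)
      also have "\<dots> = bergman_inner lam v (Ts u)" by (rule bergman_inner_cnj[symmetric])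
      finally show ?thesis .
    qed
    show "Ts u \<in> bergman_space lam \<and> (\<forall>v\<in>bergman_space lam. L2_inner lam (toeplitz lam a v) u = L2_inner lam v (Ts u))"
      by (intro conjI ballI Ts(1)[OF u]) (simp add: main L Ts(1)[OF u])
    fix w assume w: "w \<in> bergman_space lam \<and> (\<forall>v\<in>bergman_space lam. L2_inner lam (toeplitz lam a v) u = L2_inner lam v w)"
    show "w = Ts u"
    proof (rule bergman_eqI[OF lam])
      show "bergman_inner lam w v = bergman_inner lam (Ts u) v" if v: "v \<in> bergman_space lam" for v
      proof -
        have "bergman_inner lam v w = bergman_inner lam v (Ts u)" using w main[OF v] L[OF v] v by simp
        then show ?thesis using bergman_inner_cnj[of lam w v] bergman_inner_cnj[of lam "Ts u" v] by simp
      qed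
    qed (use w Ts(1)[OF u] in auto)
  qed
  have zero: "(\<lambda>Z. 0) \<in> bergman_space lam" by (rule zero_in_bergman_space)
  have ip0: "bergman_inner lam (\<lambda>Z. 0) h = 0" for h :: "complex^'n^'n \<Rightarrow> complex" by (simp add: bergman_inner_def)
  have "Ts f = (\<lambda>Z. 0)"
    by (rule bergman_eqI[OF lam Ts(1)[OF f] zero]) (simp add: Ts(2)[OF f] ker ip0)
  moreover have "toeplitz lam a (\<lambda>Z. 0) = (\<lambda>Z. 0)"
    by (rule bergman_eqI[OF lam T(1)[OF zero] zero]) (simp add: T(2)[OF zero] ip0)
  ultimately have TsT: "Ts (toeplitz lam a f) = (\<lambda>Z. 0)"
    using normal f adj[OF f] adj[OF T(1)[OF f]] unfolding bergman_normal_def by metis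
  have "bergman_inner lam (toeplitz lam a f) (toeplitz lam a f) = bergman_inner lam (\<lambda>Z. a Z * f Z) (toeplitz lam a f)"
    by (rule T(2)[OF f T(1)[OF f]])
  also have "\<dots> = cnj (bergman_inner lam (Ts (toeplitz lam a f)) f)"
    by (simp add: move Ts(2)[OF T(1)[OF f] f])
  also have "\<dots> = 0" by (simp add: TsT ip0)
  finally have "toeplitz lam a f = (\<lambda>Z. 0)" by (rule bergman_inner_self_eq_0[OF lam T(1)[OF f]])
  then show False using T(2)[OF f h0(1)] h0(2) by (simp add: ip0)
qed

section \<open>Scaling one row or one column\<close>

lemma coordinate_in_bergman_space:
  fixes r s :: "'n::finite"
  assumes lam: "lam > 2 * real CARD('n) - 1"
  shows "(\<lambda>Z::complex^'n^'n. if Z \<in> cartan_domain then Z $ r $ s else 0) \<in> bergman_space lam"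
proof -
  let ?f = "\<lambda>Z::complex^'n^'n. if Z \<in> cartan_domain then Z $ r $ s else 0"
  interpret finite_measure "borel_bergman_measure lam :: (complex^'n^'n) measure" by (rule finite_measure_borel_bergman_measure[OF lam])
  have hol: "holomorphic_on_matrices ?f cartan_domain"
    unfolding holomorphic_on_matrices_iff
  proof
    fix Z :: "complex^'n^'n" assume Z: "Z \<in> cartan_domain"
    have "bounded_linear (\<lambda>Z::complex^'n^'n. Z $ r $ s)"
      by (rule bounded_linear_compose[OF bounded_linear_vec_nth bounded_linear_vec_nth])
    then have "((\<lambda>Z::complex^'n^'n. Z $ r $ s) has_derivative (\<lambda>Z. Z $ r $ s)) (at Z)"
      by (rule bounded_linear_imp_has_derivative)
    then have "(?f has_derivative (\<lambda>Z. Z $ r $ s)) (at Z)"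
      by (rule has_derivative_transform_within_open[OF _ open_cartan_domain Z]) simp
    then show "\<exists>f'. complex_deriv ?f f' Z" unfolding complex_deriv_def by auto
  qed
  have [measurable]: "?f \<in> borel_measurable borel"
    using holomorphic_extension_measurable(2)[OF hol] by simp
  have "integrable (borel_bergman_measure lam) (\<lambda>Z. (cmod (?f Z))\<^sup>2)"
  proof (rule integrable_const_bound[of _ 1])
    have "(cmod (?f Z))\<^sup>2 \<le> 1" for Z :: "complex^'n^'n"
      using cartan_domain_entry_le[of Z r s] by (simp add: power_le_one)
    then show "AE Z in borel_bergman_measure lam. norm ((cmod (?f Z))\<^sup>2) \<le> 1" by simp
  qed measurable
  then show ?thesis unfolding bergman_space_iff sq_integrable_bergman_iff using hol by auto
qed

text \<open>The cases of columns and rows are treated together: a Boolean selects whether the \<open>j\<close>-th column or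
  the \<open>j\<close>-th row is multiplied by \<open>t\<close>.\<close>

definition line_scale :: "bool \<Rightarrow> 'n \<Rightarrow> complex \<Rightarrow> complex^'n^'n \<Rightarrow> complex^'n^'n" where
  "line_scale col j t Z =
    (let D = diag (\<lambda>i. if i = j then t else 1) in if col then Z ** D else D ** Z)"

lemma line_scale_cases:
  "line_scale col j t = (\<lambda>Z. diag (\<lambda>i. if i = j then t else 1) ** Z) \<or>
   line_scale col j t = (\<lambda>Z. Z ** diag (\<lambda>i. if i = j then t else 1))"
  by (cases col) (simp_all add: line_scale_def[abs_def] Let_def)

lemma line_scale_cartan_domain:
  assumes "Z \<in> cartan_domain" "cmod t \<le> 1" shows "line_scale col j t Z \<in> cartan_domain"
  using assms cartan_domain_diag[of Z "\<lambda>i. if i = j then t else 1"] by (simp add: line_scale_def Let_def)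

lemma line_scale_unimodular:
  assumes "cmod t = 1" shows "line_scale col j t Z \<in> cartan_domain \<longleftrightarrow> Z \<in> cartan_domain"
proof
  have "line_scale col j (cnj t) (line_scale col j t Z) = Z"
    using assms by (auto simp: line_scale_def Let_def vec_eq_iff mult.assoc complex_norm_square[symmetric])
                   (simp_all add: complex_norm_square[symmetric] mult.commute[of "cnj t"] assms flip: mult.assoc)
  then show "line_scale col j t Z \<in> cartan_domain \<Longrightarrow> Z \<in> cartan_domain"
    using line_scale_cartan_domain[of "line_scale col j t Z" "cnj t" col j] assms by simp
qed (use line_scale_cartan_domain[of Z t col j] assms in auto)

lemma line_scale_affine:
  "line_scale col j t Z = line_scale col j 0 Z + cscale t (Z - line_scale col j 0 Z)"
  by (auto simp: line_scale_def Let_def vec_eq_iff)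

text \<open>The integrand is the boundary value of \<open>z h (line_scale col j z Z)\<close>, which is holomorphic near the
  closed unit disc and vanishes at 0.\<close>

lemma line_scale_mean_zero:
  fixes h :: "complex^'n^'n \<Rightarrow> complex"
  assumes h: "holomorphic_on_matrices h cartan_domain" and Z: "Z \<in> cartan_domain"
  shows "(\<integral>t. rot t * h (line_scale col j (rot t) Z) \<partial>angle_measure) = 0"
proof -
  define Z0 where "Z0 = line_scale col j 0 Z"
  define W where "W = Z - Z0"
  have ls: "line_scale col j t Z = Z0 + cscale t W" for t
    unfolding Z0_def W_def by (rule line_scale_affine)
  have hol: "(\<lambda>z. z * h (Z0 + cscale z W)) holomorphic_on {z. Z0 + cscale z W \<in> cartan_domain}"
    by (intro holomorphic_intros holomorphic_on_line h open_cartan_domain)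
  have sub: "cball 0 1 \<subseteq> {z. Z0 + cscale z W \<in> cartan_domain}"
    using line_scale_cartan_domain[OF Z, of _ col j] by (auto simp: ls)
  show ?thesis
    using circle_mean_value(2)[OF holomorphic_on_line(2)[OF h open_cartan_domain] sub hol] by (simp add: ls)
qed

text \<open>A function of negative degree in the \<open>j\<close>-th row or column is orthogonal to all holomorphic functions,
  which have only nonnegative degrees there.\<close>

lemma bergman_inner_line_scale_eq_0:
  fixes u h :: "complex^'n^'n \<Rightarrow> complex"
  assumes lam: "lam > 2 * real CARD('n) - 1"
    and u: "sq_integrable (borel_bergman_measure lam) u" and u0: "\<And>Z. Z \<notin> cartan_domain \<Longrightarrow> u Z = 0"
    and us: "\<And>t Z. cmod t = 1 \<Longrightarrow> u (line_scale col j t Z) = cnj t * u Z"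
    and h: "h \<in> bergman_space lam"
  shows "bergman_inner lam u h = 0"
proof -
  interpret T: finite_measure angle_measure by (rule finite_measure_angle_measure)
  interpret B: finite_measure "borel_bergman_measure lam :: (complex^'n^'n) measure" by (rule finite_measure_borel_bergman_measure[OF lam])
  interpret P: pair_sigma_finite "borel_bergman_measure lam :: (complex^'n^'n) measure" angle_measure ..
  have [measurable]: "u \<in> borel_measurable borel" "h \<in> borel_measurable borel"
    using u bergman_spaceD(4)[OF h] by (auto simp: sq_integrable_bergman_iff)
  define S where "S t = line_scale col j (rot t)" for t
  define q where "q Z t = u Z * cnj (rot t * h (S t Z))" for Z t
  have d: "cmod (if i = j then rot t else 1) = 1" for i t by simp
  have S: "S t = (\<lambda>Z. diag (\<lambda>i. if i = j then rot t else 1) ** Z) \<or> S t = (\<lambda>Z. Z ** diag (\<lambda>i. if i = j then rot t else 1))" for t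
    unfolding S_def by (rule line_scale_cases)
  have q_eq: "q Z t = u (S t Z) * cnj (h (S t Z))" for Z t
    by (simp add: q_def S_def us mult_ac)
  have [measurable]: "(\<lambda>(Z, t). S t Z) \<in> borel_measurable (borel_bergman_measure lam \<Otimes>\<^sub>M angle_measure)"
  proof -
    have [measurable]: "(\<lambda>t. Re (rot t)) \<in> borel_measurable angle_measure" "(\<lambda>t. Im (rot t)) \<in> borel_measurable angle_measure"
      by (rule borel_measurable_continuous_on[OF _ rot_measurable], intro continuous_intros)+
    have "linear (line_scale col j 0)"
      using line_scale_cases[of col j 0] linear_diag_mult by metis
    then have [measurable]: "line_scale col j 0 \<in> borel_measurable borel"
      by (intro borel_measurable_continuous_onI continuous_on_linear_comp)
    show ?thesis
      unfolding S_def line_scale_affine[of col j "rot _"] cscale_eq[of "rot _"] by measurable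
  qed
  have qm [measurable]: "(\<lambda>(Z, t). q Z t) \<in> borel_measurable (borel_bergman_measure lam \<Otimes>\<^sub>M angle_measure)"
    unfolding q_def by measurable
  have uh: "integrable (borel_bergman_measure lam) (\<lambda>Z. u Z * cnj (h Z))"
    by (rule sq_integrable_integrable_mult[OF u bergman_spaceD(1)[OF h]])
  have qi: "integrable (borel_bergman_measure lam \<Otimes>\<^sub>M angle_measure) (\<lambda>(Z, t). q Z t)"
  proof (rule integrableI_bounded[OF qm])
    have "(\<integral>\<^sup>+x. ennreal (norm (case x of (Z, t) \<Rightarrow> q Z t)) \<partial>(borel_bergman_measure lam \<Otimes>\<^sub>M angle_measure))
        = (\<integral>\<^sup>+t. (\<integral>\<^sup>+Z. ennreal (norm (q Z t)) \<partial>borel_bergman_measure lam) \<partial>angle_measure)"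
      by (subst P.nn_integral_snd[symmetric]) (auto intro!: nn_integral_cong)
    also have "\<dots> = (\<integral>\<^sup>+t. (\<integral>\<^sup>+Z. ennreal (norm (u Z * cnj (h Z))) \<partial>borel_bergman_measure lam) \<partial>angle_measure)"
    proof (rule nn_integral_cong)
      fix t
      show "(\<integral>\<^sup>+Z. ennreal (norm (q Z t)) \<partial>borel_bergman_measure lam) = (\<integral>\<^sup>+Z. ennreal (norm (u Z * cnj (h Z))) \<partial>borel_bergman_measure lam)"
        unfolding q_eq by (rule nn_integral_borel_bergman_measure_diag[OF _ d S, where F="\<lambda>Z. ennreal (norm (u Z * cnj (h Z)))"]) measurable
    qed
    also have "\<dots> = (\<integral>\<^sup>+Z. ennreal (norm (u Z * cnj (h Z))) \<partial>borel_bergman_measure lam)" by simp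
    also have "\<dots> < \<infinity>" using uh by (simp only: integrable_iff_bounded)
    finally show "(\<integral>\<^sup>+x. ennreal (norm (case x of (Z, t) \<Rightarrow> q Z t)) \<partial>(borel_bergman_measure lam \<Otimes>\<^sub>M angle_measure)) < \<infinity>" .
  qed
  (* For each t the inner product is the integral of the rotated integrand q; average over t
     and integrate over t first. *)
  have "bergman_inner lam u h = (\<integral>t. bergman_inner lam u h \<partial>angle_measure)"
    by (simp add: measure_def)
  also have "\<dots> = (\<integral>t. (\<integral>Z. q Z t \<partial>borel_bergman_measure lam) \<partial>angle_measure)"
  proof (rule Bochner_Integration.integral_cong[OF refl])
    fix t
    show "bergman_inner lam u h = (\<integral>Z. q Z t \<partial>borel_bergman_measure lam)"
      unfolding q_eq bergman_inner_def by (rule integral_borel_bergman_measure_diag[OF _ d S, where F="\<lambda>Z. u Z * cnj (h Z)", symmetric]) measurable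
  qed
  also have "\<dots> = (\<integral>Z. (\<integral>t. q Z t \<partial>angle_measure) \<partial>borel_bergman_measure lam)"
    by (rule P.Fubini_integral[OF qi])
  also have "\<dots> = (\<integral>Z. 0 \<partial>(borel_bergman_measure lam :: (complex^'n^'n) measure))"
  proof (rule Bochner_Integration.integral_cong[OF refl])
    fix Z :: "complex^'n^'n"
    have "(\<integral>t. q Z t \<partial>angle_measure) = u Z * cnj (\<integral>t. rot t * h (S t Z) \<partial>angle_measure)"
      unfolding q_def by (simp only: integral_mult_right_zero Bochner_Integration.integral_cnj)
    also have "\<dots> = 0"
      using u0[of Z] line_scale_mean_zero[OF bergman_spaceD(2)[OF h], of Z col j]
      by (cases "Z \<in> cartan_domain") (auto simp: S_def)
    finally show "(\<integral>t. q Z t \<partial>angle_measure) = 0" .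
  qed
  finally show ?thesis by simp
qed

section \<open>The Gram symbols\<close>

definition line_entry :: "bool \<Rightarrow> complex^'n^'n \<Rightarrow> 'n \<Rightarrow> 'n \<Rightarrow> complex" where
  "line_entry col Z k i = (if col then Z $ k $ i else Z $ i $ k)"

text \<open>The entry \<open>(i, j)\<close> of \<open>Z\<^sup>* Z\<close> in the case of columns and the entry \<open>(j, i)\<close> of \<open>Z Z\<^sup>*\<close> in the case of
  rows: in both cases scaling the \<open>j\<close>-th line by \<open>t\<close> multiplies the symbol by \<open>t\<close>.\<close>

definition gram_symbol :: "bool \<Rightarrow> 'n \<Rightarrow> 'n \<Rightarrow> complex^'n^'n \<Rightarrow> complex" where
  "gram_symbol col i j Z = (\<Sum>k\<in>UNIV. cnj (line_entry col Z k i) * line_entry col Z k j)"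

lemma line_entry_scale:
  "line_entry col (line_scale col j t Z) k i = (if i = j then t else 1) * line_entry col Z k i"
  by (simp add: line_entry_def line_scale_def Let_def)

lemma gram_symbol_scale:
  assumes "i \<noteq> j" shows "gram_symbol col i j (line_scale col j t Z) = t * gram_symbol col i j Z"
  using assms by (simp add: gram_symbol_def line_entry_scale sum_distrib_left mult_ac)

lemma continuous_on_line_entry [continuous_intros]: "continuous_on A (\<lambda>Z. line_entry col Z k i)"
  unfolding line_entry_def by (cases col) (auto intro!: continuous_intros)

lemma continuous_on_gram_symbol: "continuous_on A (gram_symbol col i j)"
  unfolding gram_symbol_def by (intro continuous_intros)

lemma borel_measurable_gram_symbol [measurable]: "gram_symbol col i j \<in> borel_measurable borel"
  by (intro borel_measurable_continuous_onI continuous_on_gram_symbol)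

lemma gram_symbol_bound:
  fixes Z :: "complex^'n^'n"
  assumes "Z \<in> cartan_domain" shows "cmod (gram_symbol col i j Z) \<le> real CARD('n)"
proof -
  have "cmod (gram_symbol col i j Z) \<le> (\<Sum>k\<in>(UNIV::'n set). 1)"
    unfolding gram_symbol_def
  proof (rule sum_norm_le)
    fix k
    have "cmod (line_entry col Z k l) \<le> 1" for l
      unfolding line_entry_def using cartan_domain_entry_le[OF assms] by simp
    then show "cmod (cnj (line_entry col Z k i) * line_entry col Z k j) \<le> 1"
      by (simp add: norm_mult mult_le_one)
  qed
  then show ?thesis by simp
qed

text \<open>Let \<open>x p l\<close> be the \<open>p\<close>-th coordinate in line \<open>l\<close>. The product of the conjugate symbol and \<open>x p i\<close> has
  degree \<open>-1\<close> in line \<open>j\<close>, so its projection is zero for every \<open>p\<close>. The symbol itself is the sum over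
  \<open>p\<close> of \<open>x p j\<close> times the conjugate of \<open>x p i\<close>, so the inner products of \<open>a\<cdot>x p i\<close> with \<open>x p j\<close> add up
  to the integral of \<open>|a|\<^sup>2\<close>, which is positive; one of them is therefore nonzero.\<close>

lemma gram_symbol_not_normal:
  fixes i j :: "'n::finite"
  assumes lam: "lam > 2 * real CARD('n) - 1" and ij: "i \<noteq> j"
  shows "\<not> bergman_normal lam (toeplitz lam (gram_symbol col i j))"
proof -
  let ?a = "gram_symbol col i j"
  define x where "x p l Z = (if Z \<in> cartan_domain then line_entry col Z p l else 0)" for p l and Z :: "complex^'n^'n"
  have x: "x p l \<in> bergman_space lam" for p l
    using coordinate_in_bergman_space[OF lam, of p l] coordinate_in_bergman_space[OF lam, of l p]
    by (cases col) (simp_all add: x_def[abs_def] line_entry_def cong: if_cong)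
  have [measurable]: "x p l \<in> borel_measurable borel" for p l by (rule bergman_spaceD(4)[OF x])
  have sq: "sq_integrable (borel_bergman_measure lam) (\<lambda>Z. ?a Z * x p l Z)" for p l
    by (rule sq_integrable_symbol_mult[OF _ gram_symbol_bound x]) simp_all
  have csq: "sq_integrable (borel_bergman_measure lam) (\<lambda>Z. cnj (?a Z) * x p l Z)" for p l
    by (rule sq_integrable_symbol_mult[OF _ _ x, of _ "real CARD('n)"]) (simp_all add: gram_symbol_bound)
  have ker: "bergman_inner lam (\<lambda>Z. cnj (?a Z) * x p i Z) h = 0" if "h \<in> bergman_space lam" for h p
  proof (rule bergman_inner_line_scale_eq_0[OF lam csq _ _ that, of _ _ col j])
    show "cnj (?a Z) * x p i Z = 0" if "Z \<notin> cartan_domain" for Z using that by (simp add: x_def)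
    show "cnj (?a (line_scale col j t Z)) * x p i (line_scale col j t Z) = cnj t * (cnj (?a Z) * x p i Z)"
      if "cmod t = 1" for t Z
      using ij by (simp add: x_def line_scale_unimodular[OF that] gram_symbol_scale line_entry_scale)
  qed
  have "\<exists>p. bergman_inner lam (\<lambda>Z. ?a Z * x p i Z) (x p j) \<noteq> 0"
  proof (rule ccontr)
    assume "\<not> (\<exists>p. bergman_inner lam (\<lambda>Z. ?a Z * x p i Z) (x p j) \<noteq> 0)"
    then have "(\<Sum>p\<in>UNIV. bergman_inner lam (\<lambda>Z. ?a Z * x p i Z) (x p j)) = 0" by simp
    moreover have "(\<Sum>p\<in>UNIV. bergman_inner lam (\<lambda>Z. ?a Z * x p i Z) (x p j))
        = (\<integral>Z. (\<Sum>p\<in>UNIV. ?a Z * x p i Z * cnj (x p j Z)) \<partial>borel_bergman_measure lam)"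
      unfolding bergman_inner_def
      by (rule Bochner_Integration.integral_sum[symmetric]) (rule sq_integrable_integrable_mult[OF sq bergman_spaceD(1)[OF x]])
    moreover have pt: "(\<Sum>p\<in>UNIV. ?a Z * x p i Z * cnj (x p j Z)) = of_real (indicator cartan_domain Z * (cmod (?a Z))\<^sup>2)" for Z
    proof (cases "Z \<in> cartan_domain")
      case True
      then have "(\<Sum>p\<in>UNIV. ?a Z * x p i Z * cnj (x p j Z)) = ?a Z * cnj (?a Z)"
        by (simp add: x_def gram_symbol_def[of col i j Z] sum_distrib_left mult.assoc)
      then show ?thesis using True by (simp add: complex_norm_square[symmetric])
    qed (simp add: x_def)
    ultimately have "(\<integral>Z. complex_of_real (indicator cartan_domain Z * (cmod (?a Z))\<^sup>2) \<partial>borel_bergman_measure lam) = 0"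
      by (simp only: pt)
    then have int0: "(\<integral>Z. indicator cartan_domain Z * (cmod (?a Z))\<^sup>2 \<partial>borel_bergman_measure lam) = 0"
      by (simp only: integral_complex_of_real of_real_eq_0_iff)
    have "integrable (borel_bergman_measure lam) (\<lambda>Z. \<Sum>p\<in>UNIV. ?a Z * x p i Z * cnj (x p j Z))"
      by (intro Bochner_Integration.integrable_sum sq_integrable_integrable_mult[OF sq bergman_spaceD(1)[OF x]])
    then have "integrable (borel_bergman_measure lam) (\<lambda>Z. indicator cartan_domain Z * (cmod (?a Z))\<^sup>2)"
      unfolding pt complex_of_real_integrable_eq .
    then have "AE Z in borel_bergman_measure lam. indicator cartan_domain Z * (cmod (?a Z))\<^sup>2 = 0"
      using int0 by (subst (asm) integral_nonneg_eq_0_iff_AE) auto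
    then have ae: "AE Z in borel_bergman_measure lam. Z \<notin> {Z \<in> cartan_domain. ?a Z \<noteq> 0}"
      by (rule eventually_mono) (auto simp: indicator_def)
    have "open (cartan_domain \<inter> ?a -` (- {0}))"
      by (rule continuous_open_preimage[OF continuous_on_gram_symbol open_cartan_domain]) auto
    also have "cartan_domain \<inter> ?a -` (- {0}) = {Z \<in> cartan_domain. ?a Z \<noteq> 0}" by auto
    finally have empty: "{Z \<in> cartan_domain. ?a Z \<noteq> 0} = {}"
      by (intro borel_bergman_measure_open_pos[OF lam _ _ ae]) auto
    obtain e where e: "e > 0" "ball 0 e \<subseteq> (cartan_domain :: (complex^'n^'n) set)"
      using open_cartan_domain zero_in_cartan_domain open_contains_ball by blast
    (* The symbol does not vanish at small multiples of the matrix whose entries are all 1. *)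
    define J :: "complex^'n^'n" where "J = (\<chi> k l. 1)"
    define \<epsilon> where "\<epsilon> = e / 2 / (norm J + 1)"
    have pos: "norm J + 1 > 0" using norm_ge_zero[of J] by linarith
    have \<epsilon>: "\<epsilon> > 0" using e pos by (simp add: \<epsilon>_def)
    have "\<epsilon> * norm J < \<epsilon> * (norm J + 1)" using \<epsilon> by simp
    also have "\<dots> = e / 2" unfolding \<epsilon>_def using pos by (metis nonzero_eq_divide_eq less_irrefl)
    finally have "norm (\<epsilon> *\<^sub>R J) < e" using e(1) \<epsilon> by simp
    then have "\<epsilon> *\<^sub>R J \<in> cartan_domain" using e by (auto simp: dist_norm)
    moreover have "?a (\<epsilon> *\<^sub>R J) = of_real (real CARD('n) * \<epsilon>\<^sup>2)"
    proof -
      have "(\<epsilon> *\<^sub>R J) $ k $ l = of_real \<epsilon>" for k l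
        by (simp add: J_def) (simp add: scaleR_conv_of_real)
      then have "line_entry col (\<epsilon> *\<^sub>R J) k l = of_real \<epsilon>" for k l
        unfolding line_entry_def by presburger
      then show ?thesis by (simp add: gram_symbol_def power2_eq_square)
    qed
    ultimately show False using empty \<epsilon> by auto
  qed
  then obtain p where p: "bergman_inner lam (\<lambda>Z. ?a Z * x p i Z) (x p j) \<noteq> 0" by blast
  show ?thesis
    by (rule toeplitz_not_normalI[OF lam _ gram_symbol_bound x[of p i] ker x[of p j] p]) simp_all
qed

lemma gram_symbol_Linf: "gram_symbol col i j \<in> Linf"
  unfolding Linf_def
proof (intro CollectI conjI exI)
  show "gram_symbol col i j \<in> borel_measurable (lebesgue_on cartan_domain)" by (rule borel_measurable_lebesgue_on) simp
  show "AE Z in lebesgue_on cartan_domain. cmod (gram_symbol col i j Z) \<le> real CARD('a)"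
    using gram_symbol_bound by (intro AE_I2) (simp add: space_restrict_space)
qed

lemma gram_symbol_eq:
  "gram_symbol True i j Z = (conj_transpose Z ** Z) $ i $ j"
  "gram_symbol False i j Z = (Z ** conj_transpose Z) $ j $ i"
  by (simp_all add: gram_symbol_def line_entry_def matrix_matrix_mult_def mult.commute)

lemma gram_symbol_Linf_left:
  fixes i j :: "'n::finite"
  shows "gram_symbol True i j \<in> Linf_left"
  unfolding Linf_left_def
proof (intro CollectI conjI ballI gram_symbol_Linf)
  fix U :: "complex^'n^'n" assume "U \<in> unitary_group"
  then have U: "conj_transpose U ** U = mat 1" by (simp add: unitary_group_def)
  have "conj_transpose (U ** Z) ** (U ** Z) = conj_transpose Z ** (conj_transpose U ** U) ** Z" for Z :: "complex^'n^'n"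
    by (simp add: conj_transpose_mult matrix_mul_assoc)
  then show "AE Z in lebesgue_on cartan_domain. gram_symbol True i j (U ** Z) = gram_symbol True i j Z"
    by (simp add: gram_symbol_eq U)
qed

lemma gram_symbol_Linf_right:
  fixes i j :: "'n::finite"
  shows "gram_symbol False i j \<in> Linf_right"
  unfolding Linf_right_def
proof (intro CollectI conjI ballI gram_symbol_Linf)
  fix V :: "complex^'n^'n" assume "V \<in> unitary_group"
  then have V: "V ** conj_transpose V = mat 1" by (simp add: unitary_group_def)
  have "(Z ** V) ** conj_transpose (Z ** V) = Z ** (V ** conj_transpose V) ** conj_transpose Z" for Z :: "complex^'n^'n"
    by (simp add: conj_transpose_mult matrix_mul_assoc)
  then show "AE Z in lebesgue_on cartan_domain. gram_symbol False i j (Z ** V) = gram_symbol False i j Z"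
    by (simp add: gram_symbol_eq V)
qed

theorem theorem4p15:
  fixes lam :: real
  assumes "CARD('n::finite) \<ge> 2"
    and "lam > 2 * real CARD('n) - 1"
  shows "\<exists>a \<in> (Linf_left :: (complex^'n^'n \<Rightarrow> complex) set).
         \<exists>b \<in> (Linf_right :: (complex^'n^'n \<Rightarrow> complex) set).
           \<not> bergman_normal lam (toeplitz lam a) \<and> \<not> bergman_normal lam (toeplitz lam b)"
proof -
  have "\<not> is_singleton (UNIV :: 'n set)"
    using assms(1) by (simp add: is_singleton_altdef)
  then obtain i j :: 'n where "i \<noteq> j"
    by (metis UNIV_I UNIV_eq_I is_singletonI insertI1 singletonI)
  then show ?thesis
    using gram_symbol_not_normal[OF assms(2)] gram_symbol_Linf_left gram_symbol_Linf_right by blast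
qed

end
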